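(* Let $A,B,Q,W,R$ be the matrix-valued functions on $\mathcal{M}$ attached (see context) to the sampled-data system and the weights $Q_c\ge 0$, $R_c>0$. Define $\bar A(\phi):=A(\phi)-B(\phi)R(\phi)^{-1}W(\phi)^{\top}$ for $\phi\in\mathcal{M}$, and let $C(\phi),D(\phi)$ be matrices obtained from the Cholesky decompositions $$C(\phi)^{\top}C(\phi)=Q(\phi)-W(\phi)R(\phi)^{-1}W(\phi)^{\top},\qquad D(\phi)^{\top}D(\phi)=R(\phi)\qquad \forall \phi\in\mathcal{M}.$$ Then a control input $u^{\rm opt}$ is a solution of the sampled-data LQ problem, i.e. $u^{\rm opt}\in\mathcal{U}_c$ and $\mathcal{J}_c(\widehat\mu,u^{\rm opt})=\inf_{u\in\mathcal{U}_c}\mathcal{J}_c(\widehat\mu,u)$ for every admissible initial distribution $\widehat\mu$, if and only if the control input $\bar u^{\rm opt}$ given by $\bar u^{\rm opt}_k=u^{\rm opt}_k+R(\phi_k)^{-1}W(\phi_k)^{\top}\xi_k$ $(k\in\mathbb{Z}_+)$ is a solution of the discrete-time LQ problem for the Markov jump system $$\xi_{k+1}=\bar A(\phi_k)\xi_k+B(\phi_k)\bar u_k$$ with cost $$\mathcal{J}_{d2}(\widehat\mu,\bar u):=\sum_{k=0}^{\infty}E\left(\|C(\phi_k)\xi_k\|^2+\|D(\phi_k)\bar u_k\|^2\right),$$ i.e. $\bar u^{\rm opt}\in\mathcal{U}_d$ (the class $\mathcal{U}_d$ for this system) and $\mathcal{J}_{d2}(\widehat\mu,\bar u^{\rm opt})=\inf_{\bar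 u\in\mathcal{U}_d}\mathcal{J}_{d2}(\widehat\mu,\bar u)$ for every admissible initial distribution $\widehat\mu$.
   Context: Sampled-data system. Fix a probability space $(\Omega,\mathcal{F},P)$, $h>0$, $p\in\mathbb{N}$, real matrices $A_c\in\mathbb{R}^{n\times n}$, $B_c\in\mathbb{R}^{n\times m}$, and symmetric $Q_c\ge0$ ($n\times n$), $R_c>0$ ($m\times m$). The plant is $\dot x(t)=A_cx(t)+B_cu(t)$, $x(0)=x_0$, with input $u(t)=u_{-1}$ for $0\le t<\tau_0$ and $u(t)=u_k$ for $kh+\tau_k\le t<(k+1)h+\tau_{k+1}$, $k\in\mathbb{Z}_+=\{0,1,2,\dots\}$. Delays. $\phi_k:=[\tau_k,\dots,\tau_{k-p+1}]^{\top}$, $k\in\mathbb{Z}_+$, is a time-homogeneous Markov chain with values in $\mathcal{M}:=[\tau_{\min},\tau_{\max}]^p\subset[0,h)^p$, whose transition kernel has a density $g$ with respect to a $\sigma$-finite measure $\mu$ on $\mathcal{M}$: $P(\phi_{k+1}\in\mathcal{B}\mid\phi_k=\phi)=\int_{\mathcal{B}}g(\phi,\ell)\,\mu(d\ell)$ for Borel $\mathcal{B}\subset\mathcal{M}$. Initial distribution. Put $\xi_k:=[x(kh)^{\top},u_{k-1}^{\top}]^{\top}$, so $\xi_0=[x_0^{\top},u_{-1}^{\top}]^{\top}$. $\widehat\mu$ denotes the distribution of $(\xi_0,\phi_0)$ on $\mathbb{R}^{n+m}\times\mathcal{M}$. It is called admissible if $E(\|\xi_0\|^2)<\infty$ and the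 marginal $\widehat\mu_{\mathcal{M}}(\cdot)=\widehat\mu(\mathbb{R}^{n+m}\times\cdot)$ is absolutely continuous with respect to $\mu$. Control classes. $\mathcal{F}_k$ is the $\sigma$-field generated by $u_{-1},x(0),\phi_0,\dots,x(kh),\phi_k$. $\mathcal{U}_c$ is the class of control inputs (control laws) $u=\{u_k\}_{k\in\mathbb{Z}_+}$ such that $u_k$ is $\mathcal{F}_k$-measurable and, for the sampled-data system, $E(\|x(t)\|^2)\to0$ as $t\to\infty$ and $E(\|u_k\|^2)\to0$ as $k\to\infty$ for every admissible $\widehat\mu$. For a discrete-time system with state $\xi_k$, $\mathcal{F}^d_k$ is the $\sigma$-field generated by $\xi_0,\phi_0,\dots,\xi_k,\phi_k$, and $\mathcal{U}_d$ is the class of control inputs such that the $k$-th input is $\mathcal{F}^d_k$-measurable and $E(\|\xi_k\|^2)\to0$ as $k\to\infty$ for every admissible $\widehat\mu$. Cost. $\mathcal{J}_c(\widehat\mu,u):=E\left(\int_0^\infty x(t)^{\top}Q_cx(t)+u(t)^{\top}R_cu(t)\,dt\right)$. Matrices. For $\phi\in\mathcal{M}$ with first entry $\tau$: $$A(\phi):=\begin{bmatrix}A_d&B_d-\Gamma(\tau)\\ 0&0\end{bmatrix},\quad B(\phi):=\begin{bmatrix}\Gamma(\tau)\\ I\end{bmatrix},\quad A_d:=e^{A_ch},\ B_d:=\int_0^he^{A_cs}B_cds,\ \Gamma(\tau):=\int_0^{h-\tau}e^{A_cs}B_cds.$$ With $\alpha(\theta):=e^{A_c\theta}$, $\beta(\theta):=\int_0^\theta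 e^{A_cs}B_cds$, $\gamma(\tau,\theta):=\int_0^{\theta-\tau}e^{A_cs}B_cds$: $$Q(\phi):=\begin{bmatrix}Q_{11}(\tau)&Q_{12}(\tau)\\ Q_{12}(\tau)^{\top}&Q_{22}(\tau)\end{bmatrix},\qquad W(\phi):=\int_\tau^h\begin{bmatrix}\alpha(\theta)^{\top}Q_c\gamma(\tau,\theta)\\ \beta(\theta)^{\top}Q_c\gamma(\tau,\theta)-\gamma(\tau,\theta)^{\top}Q_c\gamma(\tau,\theta)\end{bmatrix}d\theta,$$ $$R(\phi):=(h-\tau)R_c+\int_\tau^h\gamma(\tau,\theta)^{\top}Q_c\gamma(\tau,\theta)d\theta,\qquad Q_{11}(\tau):=\int_0^h\alpha(\theta)^{\top}Q_c\alpha(\theta)d\theta,$$ $$Q_{12}(\tau):=\int_0^h\alpha(\theta)^{\top}Q_c\beta(\theta)d\theta-\int_\tau^h\alpha(\theta)^{\top}Q_c\gamma(\tau,\theta)d\theta,$$ $$Q_{22}(\tau):=\tau R_c+\int_0^h\beta(\theta)^{\top}Q_c\beta(\theta)d\theta+\int_\tau^h\gamma(\tau,\theta)^{\top}Q_c\gamma(\tau,\theta)d\theta-\int_\tau^h\left(\beta(\theta)^{\top}Q_c\gamma(\tau,\theta)+\gamma(\tau,\theta)^{\top}Q_c\beta(\theta)\right)d\theta.$$ $R(\phi)$ is positive definite, hence invertible, for every $\phi\in\mathcal{M}$. *)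

theory Defs
  imports "HOL-Probability.Probability"
begin

text \<open>
  The data of the sampled-data problem.  Only the underlying measurable space of
  \<open>sample\<close> is used: it is the pair \<open>(\<Omega>, \<F>)\<close> carrying the random variables
  \<open>x_init\<close> (\<open>x(0)\<close>), \<open>u_init\<close> (\<open>u\<^sub>-\<^sub>1\<close>) and \<open>delay j\<close> (\<open>\<tau>\<^sub>j\<close>, with \<open>j > -p\<close>).
  A control input is one \<open>\<F>\<^sub>k\<close>-adapted process on \<open>\<Omega>\<close> that has to perform for every admissible
  distribution of the initial data, so it is the probability measure that depends on this
  distribution: \<open>prob_of \<nu>\<close> is the measure \<open>P\<close> on \<open>(\<Omega>, \<F>)\<close> under which \<open>(\<xi>\<^sub>0, \<phi>\<^sub>0)\<close> has
  distribution \<open>\<nu>\<close> (as usual for Markov processes with varying initial distribution).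
\<close>

record ('n, 'm, 'w) sampled_system =
  Ac :: "real ^ 'n ^ 'n"
  Bc :: "real ^ 'm ^ 'n"
  Qc :: "real ^ 'n ^ 'n"
  Rc :: "real ^ 'm ^ 'm"
  period :: real
  lags :: nat
  tau_min :: real
  tau_max :: real
  ref_measure :: "(nat \<Rightarrow> real) measure"
  trans_density :: "(nat \<Rightarrow> real) \<Rightarrow> (nat \<Rightarrow> real) \<Rightarrow> real"
  sample :: "'w measure"
  x_init :: "'w \<Rightarrow> real ^ 'n"
  u_init :: "'w \<Rightarrow> real ^ 'm"
  delay :: "int \<Rightarrow> 'w \<Rightarrow> real"
  prob_of :: "((real ^ ('n + 'm)) \<times> (nat \<Rightarrow> real)) measure \<Rightarrow> 'w measure"

type_synonym ('m, 'w) control = "nat \<Rightarrow> 'w \<Rightarrow> real ^ 'm"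

definition pos_semidef :: "real ^ 'a ^ 'a \<Rightarrow> bool" where
  "pos_semidef X \<longleftrightarrow> transpose X = X \<and> (\<forall>v. 0 \<le> v \<bullet> (X *v v))"

definition pos_def :: "real ^ 'a ^ 'a \<Rightarrow> bool" where
  "pos_def X \<longleftrightarrow> transpose X = X \<and> (\<forall>v. v \<noteq> 0 \<longrightarrow> 0 < v \<bullet> (X *v v))"

definition matrix_exp :: "real ^ 'a ^ 'a \<Rightarrow> real ^ 'a ^ 'a" where
  "matrix_exp X = (\<Sum>k. (1 / fact k) *\<^sub>R (((**) X ^^ k) (mat 1)))"

definition join_vec :: "real ^ 'a \<Rightarrow> real ^ 'b \<Rightarrow> real ^ ('a + 'b)" where
  "join_vec v w = (\<chi> i. case i of Inl a \<Rightarrow> v $ a | Inr b \<Rightarrow> w $ b)"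

definition stack_mat :: "real ^ 'c ^ 'a \<Rightarrow> real ^ 'c ^ 'b \<Rightarrow> real ^ 'c ^ ('a + 'b)" where
  "stack_mat X Y = (\<chi> i. case i of Inl a \<Rightarrow> X $ a | Inr b \<Rightarrow> Y $ b)"

definition block_mat ::
  "real ^ 'a ^ 'c \<Rightarrow> real ^ 'b ^ 'c \<Rightarrow> real ^ 'a ^ 'd \<Rightarrow> real ^ 'b ^ 'd \<Rightarrow> real ^ ('a + 'b) ^ ('c + 'd)" where
  "block_mat X11 X12 X21 X22 =
     (\<chi> i. case i of Inl c \<Rightarrow> join_vec (X11 $ c) (X12 $ c) | Inr d \<Rightarrow> join_vec (X21 $ d) (X22 $ d))"

definition alpha :: "('n::finite, 'm::finite, 'w) sampled_system \<Rightarrow> real \<Rightarrow> real ^ 'n ^ 'n" where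
  "alpha S \<theta> = matrix_exp (\<theta> *\<^sub>R Ac S)"

definition beta :: "('n::finite, 'm::finite, 'w) sampled_system \<Rightarrow> real \<Rightarrow> real ^ 'm ^ 'n" where
  "beta S \<theta> = integral {0..\<theta>} (\<lambda>s. matrix_exp (s *\<^sub>R Ac S) ** Bc S)"

definition gamma :: "('n::finite, 'm::finite, 'w) sampled_system \<Rightarrow> real \<Rightarrow> real \<Rightarrow> real ^ 'm ^ 'n" where
  "gamma S \<tau> \<theta> = integral {0..\<theta> - \<tau>} (\<lambda>s. matrix_exp (s *\<^sub>R Ac S) ** Bc S)"

definition A_d :: "('n::finite, 'm::finite, 'w) sampled_system \<Rightarrow> real ^ 'n ^ 'n" where
  "A_d S = matrix_exp (period S *\<^sub>R Ac S)"

definition B_d :: "('n::finite, 'm::finite, 'w) sampled_system \<Rightarrow> real ^ 'm ^ 'n" where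
  "B_d S = integral {0..period S} (\<lambda>s. matrix_exp (s *\<^sub>R Ac S) ** Bc S)"

definition Gam :: "('n::finite, 'm::finite, 'w) sampled_system \<Rightarrow> real \<Rightarrow> real ^ 'm ^ 'n" where
  "Gam S \<tau> = integral {0..period S - \<tau>} (\<lambda>s. matrix_exp (s *\<^sub>R Ac S) ** Bc S)"

definition Q11 :: "('n::finite, 'm::finite, 'w) sampled_system \<Rightarrow> real \<Rightarrow> real ^ 'n ^ 'n" where
  "Q11 S \<tau> = integral {0..period S} (\<lambda>\<theta>. transpose (alpha S \<theta>) ** Qc S ** alpha S \<theta>)"

definition Q12 :: "('n::finite, 'm::finite, 'w) sampled_system \<Rightarrow> real \<Rightarrow> real ^ 'm ^ 'n" where
  "Q12 S \<tau> =
     integral {0..period S} (\<lambda>\<theta>. transpose (alpha S \<theta>) ** Qc S ** beta S \<theta>)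
   - integral {\<tau>..period S} (\<lambda>\<theta>. transpose (alpha S \<theta>) ** Qc S ** gamma S \<tau> \<theta>)"

definition Q22 :: "('n::finite, 'm::finite, 'w) sampled_system \<Rightarrow> real \<Rightarrow> real ^ 'm ^ 'm" where
  "Q22 S \<tau> =
     \<tau> *\<^sub>R Rc S
   + integral {0..period S} (\<lambda>\<theta>. transpose (beta S \<theta>) ** Qc S ** beta S \<theta>)
   + integral {\<tau>..period S} (\<lambda>\<theta>. transpose (gamma S \<tau> \<theta>) ** Qc S ** gamma S \<tau> \<theta>)
   - integral {\<tau>..period S} (\<lambda>\<theta>. transpose (beta S \<theta>) ** Qc S ** gamma S \<tau> \<theta>
                                 + transpose (gamma S \<tau> \<theta>) ** Qc S ** beta S \<theta>)"

text \<open>Points \<open>\<phi>\<close> of \<open>\<M>\<close> are functions on \<open>{..<p}\<close>, so their first entry \<open>\<tau>\<close> is \<open>\<phi> 0\<close>.\<close>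

definition A_mat ::
  "('n::finite, 'm::finite, 'w) sampled_system \<Rightarrow> (nat \<Rightarrow> real) \<Rightarrow> real ^ ('n + 'm) ^ ('n + 'm)" where
  "A_mat S \<phi> = block_mat (A_d S) (B_d S - Gam S (\<phi> 0)) 0 0"

definition B_mat ::
  "('n::finite, 'm::finite, 'w) sampled_system \<Rightarrow> (nat \<Rightarrow> real) \<Rightarrow> real ^ 'm ^ ('n + 'm)" where
  "B_mat S \<phi> = stack_mat (Gam S (\<phi> 0)) (mat 1)"

definition Q_mat ::
  "('n::finite, 'm::finite, 'w) sampled_system \<Rightarrow> (nat \<Rightarrow> real) \<Rightarrow> real ^ ('n + 'm) ^ ('n + 'm)" where
  "Q_mat S \<phi> =
     block_mat (Q11 S (\<phi> 0)) (Q12 S (\<phi> 0)) (transpose (Q12 S (\<phi> 0))) (Q22 S (\<phi> 0))"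

definition W_mat ::
  "('n::finite, 'm::finite, 'w) sampled_system \<Rightarrow> (nat \<Rightarrow> real) \<Rightarrow> real ^ 'm ^ ('n + 'm)" where
  "W_mat S \<phi> = integral {\<phi> 0..period S} (\<lambda>\<theta>. stack_mat
     (transpose (alpha S \<theta>) ** Qc S ** gamma S (\<phi> 0) \<theta>)
     (transpose (beta S \<theta>) ** Qc S ** gamma S (\<phi> 0) \<theta>
      - transpose (gamma S (\<phi> 0) \<theta>) ** Qc S ** gamma S (\<phi> 0) \<theta>))"

definition R_mat ::
  "('n::finite, 'm::finite, 'w) sampled_system \<Rightarrow> (nat \<Rightarrow> real) \<Rightarrow> real ^ 'm ^ 'm" where
  "R_mat S \<phi> = (period S - \<phi> 0) *\<^sub>R Rc S
     + integral {\<phi> 0..period S} (\<lambda>\<theta>. transpose (gamma S (\<phi> 0) \<theta>) ** Qc S ** gamma S (\<phi> 0) \<theta>)"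

definition A_bar ::
  "('n::finite, 'm::finite, 'w) sampled_system \<Rightarrow> (nat \<Rightarrow> real) \<Rightarrow> real ^ ('n + 'm) ^ ('n + 'm)" where
  "A_bar S \<phi> = A_mat S \<phi> - B_mat S \<phi> ** matrix_inv (R_mat S \<phi>) ** transpose (W_mat S \<phi>)"

text \<open>
  \<open>\<M> = [\<tau>\<^sub>m\<^sub>i\<^sub>n, \<tau>\<^sub>m\<^sub>a\<^sub>x]\<^sup>p\<close> with its Borel sets; a point of \<open>\<M>\<close> is a function on \<open>{..<p}\<close>, extended by
  \<open>undefined\<close>.
\<close>

definition delay_space :: "('n::finite, 'm::finite, 'w) sampled_system \<Rightarrow> (nat \<Rightarrow> real) measure" where
  "delay_space S = (\<Pi>\<^sub>M i\<in>{..<lags S}. restrict_space borel {tau_min S..tau_max S})"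

definition phi :: "('n::finite, 'm::finite, 'w) sampled_system \<Rightarrow> nat \<Rightarrow> 'w \<Rightarrow> nat \<Rightarrow> real" where
  "phi S k \<omega> = (\<lambda>i\<in>{..<lags S}. delay S (int k - int i) \<omega>)"

definition xi_init :: "('n::finite, 'm::finite, 'w) sampled_system \<Rightarrow> 'w \<Rightarrow> real ^ ('n + 'm)" where
  "xi_init S \<omega> = join_vec (x_init S \<omega>) (u_init S \<omega>)"

definition admissible ::
  "('n::finite, 'm::finite, 'w) sampled_system \<Rightarrow> ((real ^ ('n + 'm)) \<times> (nat \<Rightarrow> real)) measure \<Rightarrow> bool" where
  "admissible S \<nu> \<longleftrightarrow>
     prob_space \<nu> \<and> sets \<nu> = sets (borel \<Otimes>\<^sub>M delay_space S) \<and>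
     (\<integral>\<^sup>+z. ennreal ((norm (fst z))\<^sup>2) \<partial>\<nu>) < \<infinity> \<and>
     absolutely_continuous (ref_measure S) (distr \<nu> (delay_space S) snd)"

definition transition_kernel_density :: "('n::finite, 'm::finite, 'w) sampled_system \<Rightarrow> bool" where
  "transition_kernel_density S \<longleftrightarrow>
     sigma_finite_measure (ref_measure S) \<and> sets (ref_measure S) = sets (delay_space S) \<and>
     (\<forall>\<phi>\<in>space (delay_space S).
        trans_density S \<phi> \<in> borel_measurable (delay_space S) \<and>
        (\<forall>l\<in>space (delay_space S). 0 \<le> trans_density S \<phi> l) \<and>
        (\<integral>\<^sup>+l. ennreal (trans_density S \<phi> l) \<partial>ref_measure S) = 1) \<and>
     (\<forall>\<B>\<in>sets (delay_space S).
        (\<lambda>\<phi>. \<integral>\<^sup>+l\<in>\<B>. ennreal (trans_density S \<phi> l) \<partial>ref_measure S) \<in> borel_measurable (delay_space S))"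

definition preimages ::
  "('n::finite, 'm::finite, 'w) sampled_system \<Rightarrow> ('w \<Rightarrow> 'b) \<Rightarrow> 'b measure \<Rightarrow> 'w set set" where
  "preimages S f N = {f -` X \<inter> space (sample S) |X. X \<in> sets N}"

definition phi_history :: "('n::finite, 'm::finite, 'w) sampled_system \<Rightarrow> nat \<Rightarrow> 'w measure" where
  "phi_history S k = sigma (space (sample S)) (\<Union>j\<le>k. preimages S (phi S j) (delay_space S))"

definition markov_delays :: "('n::finite, 'm::finite, 'w) sampled_system \<Rightarrow> bool" where
  "markov_delays S \<longleftrightarrow>
     x_init S \<in> borel_measurable (sample S) \<and>
     u_init S \<in> borel_measurable (sample S) \<and>
     (\<forall>k. phi S k \<in> sample S \<rightarrow>\<^sub>M delay_space S) \<and>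
     (\<forall>\<nu>. admissible S \<nu> \<longrightarrow>
        prob_space (prob_of S \<nu>) \<and> sets (prob_of S \<nu>) = sets (sample S) \<and>
        distr (prob_of S \<nu>) (borel \<Otimes>\<^sub>M delay_space S) (\<lambda>\<omega>. (xi_init S \<omega>, phi S 0 \<omega>)) = \<nu> \<and>
        (\<forall>k. \<forall>\<B>\<in>sets (delay_space S).
           AE \<omega> in prob_of S \<nu>.
             nn_cond_exp (prob_of S \<nu>) (phi_history S k)
               (indicator {\<omega>' \<in> space (sample S). phi S (Suc k) \<omega>' \<in> \<B>}) \<omega>
             = (\<integral>\<^sup>+l\<in>\<B>. ennreal (trans_density S (phi S k \<omega>) l) \<partial>ref_measure S)))"

definition switch_time :: "('n::finite, 'm::finite, 'w) sampled_system \<Rightarrow> 'w \<Rightarrow> nat \<Rightarrow> real" where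
  "switch_time S \<omega> k = real k * period S + delay S (int k) \<omega>"

definition plant_input ::
  "('n::finite, 'm::finite, 'w) sampled_system \<Rightarrow> ('m, 'w) control \<Rightarrow> real \<Rightarrow> 'w \<Rightarrow> real ^ 'm" where
  "plant_input S u t \<omega> =
     (if t < delay S 0 \<omega> then u_init S \<omega>
      else u (THE k. switch_time S \<omega> k \<le> t \<and> t < switch_time S \<omega> (Suc k)) \<omega>)"

text \<open>
  The input is discontinuous at the switching times only, so a trajectory is a continuous function
  on \<open>[0, \<infinity>)\<close> satisfying the differential equation at all other \<open>t > 0\<close>.  It is
  uniquely determined on \<open>[0, \<infinity>)\<close>, and is only evaluated there.
\<close>

definition plant_trajectory ::
  "('n::finite, 'm::finite, 'w) sampled_system \<Rightarrow> ('m, 'w) control \<Rightarrow> 'w \<Rightarrow> (real \<Rightarrow> real ^ 'n) \<Rightarrow> bool" where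
  "plant_trajectory S u \<omega> x \<longleftrightarrow>
     continuous_on {0..} x \<and> x 0 = x_init S \<omega> \<and>
     (\<forall>t>0. t \<notin> range (switch_time S \<omega>) \<longrightarrow>
        (x has_vector_derivative (Ac S *v x t + Bc S *v plant_input S u t \<omega>)) (at t))"

definition plant_state ::
  "('n::finite, 'm::finite, 'w) sampled_system \<Rightarrow> ('m, 'w) control \<Rightarrow> real \<Rightarrow> 'w \<Rightarrow> real ^ 'n" where
  "plant_state S u t \<omega> = (SOME x. plant_trajectory S u \<omega> x) t"

definition xi ::
  "('n::finite, 'm::finite, 'w) sampled_system \<Rightarrow> ('m, 'w) control \<Rightarrow> nat \<Rightarrow> 'w \<Rightarrow> real ^ ('n + 'm)" where
  "xi S u k \<omega> = join_vec (plant_state S u (real k * period S) \<omega>)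
                          (case k of 0 \<Rightarrow> u_init S \<omega> | Suc j \<Rightarrow> u j \<omega>)"

definition F_c ::
  "('n::finite, 'm::finite, 'w) sampled_system \<Rightarrow> ('m, 'w) control \<Rightarrow> nat \<Rightarrow> 'w measure" where
  "F_c S u k = sigma (space (sample S))
     (preimages S (u_init S) borel \<union>
      (\<Union>j\<le>k. preimages S (plant_state S u (real j * period S)) borel \<union>
              preimages S (phi S j) (delay_space S)))"

text \<open>
  Second moments and costs are extended nonnegative integrals, so that \<open>\<infinity>\<close> is a
  possible value and non-integrability is not mistaken for \<open>0\<close>.
\<close>

definition U_c :: "('n::finite, 'm::finite, 'w) sampled_system \<Rightarrow> ('m, 'w) control set" where
  "U_c S = {u.
     (\<forall>k. u k \<in> borel_measurable (F_c S u k)) \<and>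
     (\<forall>\<nu>. admissible S \<nu> \<longrightarrow>
        ((\<lambda>t. \<integral>\<^sup>+\<omega>. ennreal ((norm (plant_state S u t \<omega>))\<^sup>2) \<partial>prob_of S \<nu>) \<longlongrightarrow> 0) at_top \<and>
        (\<lambda>k. \<integral>\<^sup>+\<omega>. ennreal ((norm (u k \<omega>))\<^sup>2) \<partial>prob_of S \<nu>) \<longlonglongrightarrow> 0)}"

definition J_c ::
  "('n::finite, 'm::finite, 'w) sampled_system \<Rightarrow> ((real ^ ('n + 'm)) \<times> (nat \<Rightarrow> real)) measure
     \<Rightarrow> ('m, 'w) control \<Rightarrow> ennreal" where
  "J_c S \<nu> u = (\<integral>\<^sup>+\<omega>. (\<integral>\<^sup>+t\<in>{0..}.
      ennreal (plant_state S u t \<omega> \<bullet> (Qc S *v plant_state S u t \<omega>)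
             + plant_input S u t \<omega> \<bullet> (Rc S *v plant_input S u t \<omega>)) \<partial>lborel) \<partial>prob_of S \<nu>)"

definition solves_sampled_LQ ::
  "('n::finite, 'm::finite, 'w) sampled_system \<Rightarrow> ('m, 'w) control \<Rightarrow> bool" where
  "solves_sampled_LQ S u \<longleftrightarrow>
     u \<in> U_c S \<and> (\<forall>\<nu>. admissible S \<nu> \<longrightarrow> J_c S \<nu> u = (INF v\<in>U_c S. J_c S \<nu> v))"

primrec jump_state ::
  "('n::finite, 'm::finite, 'w) sampled_system \<Rightarrow>
   ((nat \<Rightarrow> real) \<Rightarrow> real ^ ('n + 'm) ^ ('n + 'm)) \<Rightarrow> ((nat \<Rightarrow> real) \<Rightarrow> real ^ 'm ^ ('n + 'm)) \<Rightarrow>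
   ('m, 'w) control \<Rightarrow> nat \<Rightarrow> 'w \<Rightarrow> real ^ ('n + 'm)" where
  "jump_state S F G v 0 = xi_init S"
| "jump_state S F G v (Suc k) =
     (\<lambda>\<omega>. F (phi S k \<omega>) *v jump_state S F G v k \<omega> + G (phi S k \<omega>) *v v k \<omega>)"

definition F_d ::
  "('n::finite, 'm::finite, 'w) sampled_system \<Rightarrow>
   ((nat \<Rightarrow> real) \<Rightarrow> real ^ ('n + 'm) ^ ('n + 'm)) \<Rightarrow> ((nat \<Rightarrow> real) \<Rightarrow> real ^ 'm ^ ('n + 'm)) \<Rightarrow>
   ('m, 'w) control \<Rightarrow> nat \<Rightarrow> 'w measure" where
  "F_d S F G v k = sigma (space (sample S))
     (\<Union>j\<le>k. preimages S (jump_state S F G v j) borel \<union> preimages S (phi S j) (delay_space S))"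

definition U_d ::
  "('n::finite, 'm::finite, 'w) sampled_system \<Rightarrow>
   ((nat \<Rightarrow> real) \<Rightarrow> real ^ ('n + 'm) ^ ('n + 'm)) \<Rightarrow> ((nat \<Rightarrow> real) \<Rightarrow> real ^ 'm ^ ('n + 'm)) \<Rightarrow>
   ('m, 'w) control set" where
  "U_d S F G = {v.
     (\<forall>k. v k \<in> borel_measurable (F_d S F G v k)) \<and>
     (\<forall>\<nu>. admissible S \<nu> \<longrightarrow>
        (\<lambda>k. \<integral>\<^sup>+\<omega>. ennreal ((norm (jump_state S F G v k \<omega>))\<^sup>2) \<partial>prob_of S \<nu>) \<longlonglongrightarrow> 0)}"

definition J_d2 ::
  "('n::finite, 'm::finite, 'w) sampled_system \<Rightarrow>
   ((nat \<Rightarrow> real) \<Rightarrow> real ^ ('n + 'm) ^ ('n + 'm)) \<Rightarrow> ((nat \<Rightarrow> real) \<Rightarrow> real ^ 'm ^ ('n + 'm)) \<Rightarrow>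
   ((nat \<Rightarrow> real) \<Rightarrow> real ^ ('n + 'm) ^ ('n + 'm)) \<Rightarrow> ((nat \<Rightarrow> real) \<Rightarrow> real ^ 'm ^ 'm) \<Rightarrow>
   ((real ^ ('n + 'm)) \<times> (nat \<Rightarrow> real)) measure \<Rightarrow> ('m, 'w) control \<Rightarrow> ennreal" where
  "J_d2 S F G C D \<nu> v = (\<Sum>k. \<integral>\<^sup>+\<omega>.
      ennreal ((norm (C (phi S k \<omega>) *v jump_state S F G v k \<omega>))\<^sup>2
             + (norm (D (phi S k \<omega>) *v v k \<omega>))\<^sup>2) \<partial>prob_of S \<nu>)"

definition solves_jump_LQ ::
  "('n::finite, 'm::finite, 'w) sampled_system \<Rightarrow>
   ((nat \<Rightarrow> real) \<Rightarrow> real ^ ('n + 'm) ^ ('n + 'm)) \<Rightarrow> ((nat \<Rightarrow> real) \<Rightarrow> real ^ 'm ^ ('n + 'm)) \<Rightarrow>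
   ((nat \<Rightarrow> real) \<Rightarrow> real ^ ('n + 'm) ^ ('n + 'm)) \<Rightarrow> ((nat \<Rightarrow> real) \<Rightarrow> real ^ 'm ^ 'm) \<Rightarrow>
   ('m, 'w) control \<Rightarrow> bool" where
  "solves_jump_LQ S F G C D v \<longleftrightarrow>
     v \<in> U_d S F G \<and>
     (\<forall>\<nu>. admissible S \<nu> \<longrightarrow> J_d2 S F G C D \<nu> v = (INF w\<in>U_d S F G. J_d2 S F G C D \<nu> w))"

end

theory Submission
  imports Defs
begin

text \<open>
  The correspondence of the two problems is pathwise. Fix an outcome \<open>\<omega>\<close>. On one sampling period the
  plant is a linear differential equation with an input that jumps once, so
  \<open>x(kh + \<theta>) = \<alpha>(\<theta>) x(kh) + (\<beta>(\<theta>) - \<gamma>(\<tau>\<^sub>k, \<theta>)) u\<^sub>k\<^sub>-\<^sub>1 + \<gamma>(\<tau>\<^sub>k, \<theta>) u\<^sub>k\<close>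
  (\<open>plant_state_within_period\<close>). At \<open>\<theta> = h\<close> this is the recursion
  \<open>\<xi>\<^sub>k\<^sub>+\<^sub>1 = A(\<phi>\<^sub>k) \<xi>\<^sub>k + B(\<phi>\<^sub>k) u\<^sub>k\<close> (\<open>xi_Suc\<close>). Integrating the quadratic cost over the period gives
  the quadratic form with blocks \<open>Q, W, R\<close> in \<open>(\<xi>\<^sub>k, u\<^sub>k)\<close> (\<open>period_cost\<close>), and completing the square in
  \<open>u\<^sub>k\<close> turns it into \<open>|C \<xi>\<^sub>k|\<^sup>2 + |D v\<^sub>k|\<^sup>2\<close> with \<open>v\<^sub>k = u\<^sub>k + R\<^sup>-\<^sup>1 W\<^sup>T \<xi>\<^sub>k\<close>
  (\<open>stage_cost_eq_factored\<close>). In terms of \<open>v\<close> the recursion has drift \<open>A - B R\<^sup>-\<^sup>1 W\<^sup>T\<close>, so the jump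
  system driven by \<open>v\<close> passes through the states \<open>\<xi>\<^sub>k\<close> of the plant driven by \<open>u\<close> (\<open>jump_xi_eq_xi\<close>).

  The map \<open>u \<mapsto> v\<close> is onto, because \<open>u\<close> can be recovered recursively from \<open>v\<close>
  (\<open>jump_control_is_shifted\<close>), and \<open>u\<close> is an admissible control exactly when \<open>v\<close> is
  (\<open>admissible_control_iff\<close>). For the information structure (\<open>adapted_iff\<close>): the two \<open>\<sigma>\<close>-fields at
  time \<open>k\<close> differ only by the past inputs contained in \<open>\<xi>\<^sub>1, \<dots>, \<xi>\<^sub>k\<close>, and each of these
  is measurable with respect to an earlier \<open>\<sigma>\<close>-field of the plant; the gain \<open>R\<^sup>-\<^sup>1 W\<^sup>T\<close> is continuous
  in the delay, hence measurable. For the stability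
  requirement (\<open>stable_iff\<close>): \<open>\<xi>\<^sub>k\<close> consists of \<open>x(kh)\<close> and \<open>u\<^sub>k\<^sub>-\<^sub>1\<close>, and conversely the plant state
  within a period is bounded by a constant times \<open>|\<xi>\<^sub>k| + |\<xi>\<^sub>k\<^sub>+\<^sub>1|\<close>.

  All integrands are nonnegative, so sum and expectation may be exchanged and corresponding controls
  have equal costs for every initial distribution (\<open>J_c_eq_J_d2\<close>). Hence the infima agree, and
  one control is optimal if and only if the other is.
\<close>

section \<open>Continuity of matrix operations\<close>

lemma bounded_bilinear_matrix_matrix_mult:
  "bounded_bilinear ((**) :: real ^ 'b ^ 'a \<Rightarrow> real ^ 'c ^ 'b \<Rightarrow> real ^ 'c ^ 'a)"
  by (subst bilinear_conv_bounded_bilinear[symmetric])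
     (auto simp: bilinear_def vec_eq_iff matrix_matrix_mult_def algebra_simps sum.distrib
        sum_distrib_left intro!: linearI)

lemma bounded_bilinear_matrix_vector_mult:
  "bounded_bilinear ((*v) :: real ^ 'b ^ 'a \<Rightarrow> real ^ 'b \<Rightarrow> real ^ 'a)"
  by (subst bilinear_conv_bounded_bilinear[symmetric])
     (auto simp: bilinear_def vec_eq_iff matrix_vector_mult_def algebra_simps sum.distrib
        sum_distrib_left intro!: linearI)

lemma bounded_linear_transpose:
  "bounded_linear (transpose :: real ^ 'b ^ 'a \<Rightarrow> real ^ 'a ^ 'b)"
  by (subst linear_conv_bounded_linear[symmetric])
     (auto simp: vec_eq_iff transpose_def intro!: linearI)

lemmas continuous_on_matrix_mult [continuous_intros] =
  bounded_bilinear.continuous_on [OF bounded_bilinear_matrix_matrix_mult]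
lemmas continuous_on_matrix_vector_mult [continuous_intros] =
  bounded_bilinear.continuous_on [OF bounded_bilinear_matrix_vector_mult]
lemmas continuous_on_transpose [continuous_intros] =
  bounded_linear.continuous_on [OF bounded_linear_transpose]

lemma continuous_on_stack_mat [continuous_intros]:
  assumes "continuous_on T f" "continuous_on T g"
  shows "continuous_on T (\<lambda>x. stack_mat (f x :: real ^ 'c ^ 'a::finite) (g x :: real ^ 'c ^ 'b::finite))"
  unfolding stack_mat_def
proof (rule continuous_on_vec_lambda)
  fix i :: "'a + 'b"
  show "continuous_on T (\<lambda>x. case i of Inl a \<Rightarrow> f x $ a | Inr b \<Rightarrow> g x $ b)"
    by (cases i) (auto intro!: continuous_intros assms)
qed

lemma continuous_on_join_vec [continuous_intros]:
  assumes "continuous_on T f" "continuous_on T g"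
  shows "continuous_on T (\<lambda>x. join_vec (f x :: real ^ 'a::finite) (g x :: real ^ 'b::finite))"
  unfolding join_vec_def
proof (rule continuous_on_vec_lambda)
  fix i :: "'a + 'b"
  show "continuous_on T (\<lambda>x. case i of Inl a \<Rightarrow> f x $ a | Inr b \<Rightarrow> g x $ b)"
    by (cases i) (auto intro!: continuous_intros assms)
qed

lemma block_mat_eq_stack:
  "block_mat X11 X12 X21 X22 =
   stack_mat (\<chi> c. join_vec (X11 $ c) (X12 $ c)) (\<chi> d. join_vec (X21 $ d) (X22 $ d))"
  unfolding block_mat_def stack_mat_def by (simp add: vec_eq_iff cong: sum.case_cong)

lemma continuous_on_block_mat [continuous_intros]:
  fixes f11 :: "'z::topological_space \<Rightarrow> real ^ 'a::finite ^ 'c::finite"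
    and f12 :: "'z \<Rightarrow> real ^ 'b::finite ^ 'c" and f21 :: "'z \<Rightarrow> real ^ 'a ^ 'd::finite"
  assumes "continuous_on T f11" "continuous_on T f12" "continuous_on T f21" "continuous_on T f22"
  shows "continuous_on T (\<lambda>x. block_mat (f11 x) (f12 x) (f21 x) (f22 x))"
  unfolding block_mat_eq_stack by (intro continuous_intros assms)

lemma continuous_on_det:
  fixes f :: "'z::topological_space \<Rightarrow> real ^ 'n ^ 'n"
  assumes "continuous_on T f"
  shows "continuous_on T (\<lambda>x. det (f x))"
  unfolding det_def by (intro continuous_intros assms)

lemma matrix_inv_inverse:
  fixes X :: "real ^ 'n ^ 'n"
  assumes "invertible X"
  shows "X ** matrix_inv X = mat 1" "matrix_inv X ** X = mat 1"
  using someI_ex[OF assms[unfolded invertible_def]] by (auto simp: matrix_inv_def)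

text \<open>Cramer's rule reduces the continuity of the inverse to that of determinants, which are polynomials
  in the entries.\<close>

lemma matrix_inv_component:
  fixes X :: "real ^ 'n ^ 'n"
  assumes "invertible X"
  shows "matrix_inv X $ i $ j =
    det (\<chi> a b. if b = i then axis j 1 $ a else X $ a $ b) / det X"
proof -
  have "X *v (matrix_inv X *v axis j 1) = axis j 1"
    using matrix_inv_inverse(1)[OF assms] by (metis matrix_vector_mul_assoc matrix_vector_mul_lid)
  then have "matrix_inv X *v axis j 1 =
      (\<chi> k. det (\<chi> a b. if b = k then axis j 1 $ a else X $ a $ b) / det X)"
    using cramer[of X "matrix_inv X *v axis j 1" "axis j 1"] assms invertible_det_nz[of X] by simp
  moreover have "matrix_inv X $ i $ j = (matrix_inv X *v axis j 1) $ i"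
    by (simp add: matrix_vector_mult_basis column_def)
  ultimately show ?thesis by simp
qed

lemma continuous_on_matrix_inv:
  fixes f :: "'z::topological_space \<Rightarrow> real ^ 'n ^ 'n"
  assumes f: "continuous_on T f" and inv: "\<And>x. x \<in> T \<Longrightarrow> invertible (f x)"
  shows "continuous_on T (\<lambda>x. matrix_inv (f x))"
proof -
  have "continuous_on T (\<lambda>x. \<chi> i j.
      det (\<chi> a b. if b = i then axis j 1 $ a else f x $ a $ b) / det (f x))"
  proof (intro continuous_on_vec_lambda continuous_on_divide continuous_on_det f)
    show "\<forall>x\<in>T. det (f x) \<noteq> 0"
      using inv invertible_det_nz by blast
    show "continuous_on T (\<lambda>x. if b = i then axis j 1 $ a else f x $ a $ b)" for a b i j
      by (cases "b = i") (auto intro!: continuous_intros f)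
  qed
  then show ?thesis
    by (rule continuous_on_eq) (simp add: vec_eq_iff matrix_inv_component inv)
qed

section \<open>The matrix exponential\<close>

lemma matrix_power_scaleR:
  fixes X :: "real ^ 'n ^ 'n"
  shows "((**) (t *\<^sub>R X) ^^ k) (mat 1) = t ^ k *\<^sub>R ((**) X ^^ k) (mat 1)"
proof (induction k)
  case (Suc k)
  have "((**) (t *\<^sub>R X) ^^ Suc k) (mat 1) = (t *\<^sub>R X) ** (t ^ k *\<^sub>R ((**) X ^^ k) (mat 1))"
    using Suc by simp
  also have "\<dots> = t ^ Suc k *\<^sub>R (X ** ((**) X ^^ k) (mat 1))"
    by (simp add: bounded_bilinear.scaleR_left[OF bounded_bilinear_matrix_matrix_mult]
        bounded_bilinear.scaleR_right[OF bounded_bilinear_matrix_matrix_mult])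
  finally show ?case by simp
qed simp

lemma matrix_power_norm_summable:
  fixes X :: "real ^ 'n ^ 'n"
  shows "summable (\<lambda>k. norm (((**) X ^^ k) (mat 1)) / fact k * y ^ k)"
proof -
  obtain K where K: "K > 0" "\<And>(X :: real ^ 'n ^ 'n) (Y :: real ^ 'n ^ 'n). norm (X ** Y) \<le> norm X * norm Y * K"
    using bounded_bilinear.pos_bounded[OF bounded_bilinear_matrix_matrix_mult] by blast
  have P: "norm (((**) X ^^ k) (mat 1)) \<le> norm (mat 1 :: real ^ 'n ^ 'n) * (norm X * K) ^ k" for k
  proof (induction k)
    case (Suc k)
    have "norm (((**) X ^^ Suc k) (mat 1)) \<le> norm X * norm (((**) X ^^ k) (mat 1)) * K"
      using K(2)[of X "((**) X ^^ k) (mat 1)"] by simp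
    also have "\<dots> = (norm X * K) * norm (((**) X ^^ k) (mat 1))"
      by (simp add: mult.commute)
    also have "\<dots> \<le> (norm X * K) * (norm (mat 1 :: real ^ 'n ^ 'n) * (norm X * K) ^ k)"
      using Suc K(1) by (intro mult_left_mono) auto
    finally show ?case by (simp add: mult_ac)
  qed simp
  have "summable (\<lambda>k. norm (mat 1 :: real ^ 'n ^ 'n) * (inverse (fact k) * (norm X * K * \<bar>y\<bar>) ^ k))"
    by (intro summable_mult summable_exp)
  then show ?thesis
  proof (rule summable_comparison_test')
    fix k
    have "norm (norm (((**) X ^^ k) (mat 1)) / fact k * y ^ k)
        = norm (((**) X ^^ k) (mat 1)) * (\<bar>y\<bar> ^ k / fact k)"
      by (simp add: abs_mult power_abs)
    also have "\<dots> \<le> (norm (mat 1 :: real ^ 'n ^ 'n) * (norm X * K) ^ k) * (\<bar>y\<bar> ^ k / fact k)"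
      by (intro mult_right_mono P) auto
    finally show "norm (norm (((**) X ^^ k) (mat 1)) / fact k * y ^ k)
        \<le> norm (mat 1 :: real ^ 'n ^ 'n) * (inverse (fact k) * (norm X * K * \<bar>y\<bar>) ^ k)"
      by (simp add: power_mult_distrib field_simps)
  qed
qed

lemma matrix_exp_inner:
  fixes X b :: "real ^ 'n ^ 'n"
  shows "summable (\<lambda>k. (((**) X ^^ k) (mat 1) \<bullet> b) / fact k * t ^ k)"
    and "matrix_exp (t *\<^sub>R X) \<bullet> b = (\<Sum>k. (((**) X ^^ k) (mat 1) \<bullet> b) / fact k * t ^ k)"
proof -
  have s: "summable (\<lambda>k. (1 / fact k) *\<^sub>R ((**) (t *\<^sub>R X) ^^ k) (mat 1))"
    by (rule summable_comparison_test'[OF matrix_power_norm_summable[of X "\<bar>t\<bar>"]])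
       (simp add: matrix_power_scaleR power_abs field_simps)
  have eq: "(1 / fact k) *\<^sub>R ((**) (t *\<^sub>R X) ^^ k) (mat 1) \<bullet> b
      = (((**) X ^^ k) (mat 1) \<bullet> b) / fact k * t ^ k" for k
    by (simp add: matrix_power_scaleR field_simps)
  show "summable (\<lambda>k. (((**) X ^^ k) (mat 1) \<bullet> b) / fact k * t ^ k)"
    using bounded_linear.summable[OF bounded_linear_inner_left s, of b] by (simp only: eq)
  show "matrix_exp (t *\<^sub>R X) \<bullet> b = (\<Sum>k. (((**) X ^^ k) (mat 1) \<bullet> b) / fact k * t ^ k)"
    unfolding matrix_exp_def
    using bounded_linear.suminf[OF bounded_linear_inner_left s, of b] by (simp only: eq)
qed

text \<open>Tested against any matrix \<open>b\<close>, the exponential is an everywhere convergent real power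
  series, which may be differentiated termwise.\<close>

lemma matrix_exp_has_vector_derivative:
  fixes X :: "real ^ 'n ^ 'n"
  shows "((\<lambda>t. matrix_exp (t *\<^sub>R X)) has_vector_derivative X ** matrix_exp (t *\<^sub>R X)) (at t)"
  unfolding has_vector_derivative_def
proof (subst has_derivative_componentwise_within, rule ballI)
  fix b :: "real ^ 'n ^ 'n"
  let ?c = "\<lambda>k. (((**) X ^^ k) (mat 1) \<bullet> b) / fact k"
  have "((\<lambda>t. \<Sum>k. ?c k * t ^ k) has_field_derivative (\<Sum>k. diffs ?c k * t ^ k)) (at t)"
    by (rule termdiffs_strong_converges_everywhere) (rule matrix_exp_inner(1))
  also have "(\<lambda>t. \<Sum>k. ?c k * t ^ k) = (\<lambda>t. matrix_exp (t *\<^sub>R X) \<bullet> b)"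
    by (simp add: matrix_exp_inner(2))
  also have "(\<Sum>k. diffs ?c k * t ^ k) = (X ** matrix_exp (t *\<^sub>R X)) \<bullet> b"
  proof -
    \<comment> \<open>The derived series has the coefficients \<open>X X\<^sup>k / k!\<close>. Moving the factor \<open>X\<close> to the
      test matrix turns it into the exponential series again.\<close>
    have adj: "(X ** Y) \<bullet> b = Y \<bullet> adjoint ((**) X) b" for Y :: "real ^ 'n ^ 'n"
      by (rule adjoint_works[symmetric], rule bounded_linear.linear,
          rule bounded_bilinear.bounded_linear_right, rule bounded_bilinear_matrix_matrix_mult)
    have "diffs ?c = (\<lambda>k. (((**) X ^^ k) (mat 1) \<bullet> adjoint ((**) X) b) / fact k)"
      by (rule ext) (simp add: diffs_def adj field_simps del: of_nat_Suc)
    then show ?thesis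
      unfolding adj by (simp add: matrix_exp_inner(2))
  qed
  finally show "((\<lambda>t. matrix_exp (t *\<^sub>R X) \<bullet> b) has_derivative
      (\<lambda>x. x *\<^sub>R (X ** matrix_exp (t *\<^sub>R X)) \<bullet> b)) (at t)"
    unfolding has_field_derivative_def
    by (rule has_derivative_eq_rhs) (simp add: fun_eq_iff mult.commute)
qed

section \<open>Block vectors and block matrices\<close>

lemma sum_UNIV_sum:
  "sum f (UNIV :: ('a::finite + 'b::finite) set) = (\<Sum>a\<in>UNIV. f (Inl a)) + (\<Sum>b\<in>UNIV. f (Inr b))"
  unfolding UNIV_Plus_UNIV[symmetric] by (subst sum.Plus) (auto simp: o_def)

lemma join_vec_nth [simp]: "join_vec v w $ Inl a = v $ a" "join_vec v w $ Inr b = w $ b"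
  by (simp_all add: join_vec_def)

lemma vec_sum_eqI:
  "(\<And>a. v $ Inl a = w $ Inl a) \<Longrightarrow> (\<And>b. v $ Inr b = w $ Inr b) \<Longrightarrow> v = w"
  by (metis old.sum.exhaust vec_eq_iff)

lemma join_vec_add: "join_vec a b + join_vec c d = join_vec (a + c) (b + d)"
  by (rule vec_sum_eqI) simp_all

lemma inner_join_vec:
  fixes a c :: "real ^ 'a::finite" and b d :: "real ^ 'b::finite"
  shows "join_vec a b \<bullet> join_vec c d = a \<bullet> c + b \<bullet> d"
  by (simp add: inner_vec_def sum_UNIV_sum)

lemma norm_join_vec_power2:
  fixes a :: "real ^ 'a::finite" and b :: "real ^ 'b::finite"
  shows "(norm (join_vec a b))\<^sup>2 = (norm a)\<^sup>2 + (norm b)\<^sup>2"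
  by (simp add: power2_norm_eq_inner inner_join_vec)

lemma stack_mat_mult_vec: "stack_mat X Y *v c = join_vec (X *v c) (Y *v c)"
  by (rule vec_sum_eqI) (simp_all add: stack_mat_def matrix_vector_mult_def)

lemma block_mat_mult_join:
  "block_mat X11 X12 X21 X22 *v join_vec (a :: real ^ 'a::finite) (b :: real ^ 'b::finite)
     = join_vec (X11 *v a + X12 *v b) (X21 *v a + X22 *v b)"
  by (rule vec_sum_eqI) (simp_all add: block_mat_def matrix_vector_mult_def sum_UNIV_sum)

lemma inner_matrix_transpose: "(X *v a) \<bullet> b = a \<bullet> (transpose X *v b)" for X :: "real ^ 'a ^ 'b"
  by (metis dot_lmul_matrix inner_commute matrix_vector_mul_assoc transpose_matrix_vector vector_transpose_matrix)

section \<open>Free motion and step response of the plant\<close>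

lemma alpha_0 [simp]: "alpha S 0 = mat 1"
proof -
  have "matrix_exp (0 *\<^sub>R Ac S) \<bullet> b = mat 1 \<bullet> b" for b
    unfolding matrix_exp_inner(2) by (simp only: powser_zero) simp
  then show ?thesis
    by (metis alpha_def vector_eq_rdot)
qed

lemma alpha_has_vector_derivative:
  "(alpha S has_vector_derivative Ac S ** alpha S t) (at t)"
  using matrix_exp_has_vector_derivative[of "Ac S" t] by (simp add: alpha_def[abs_def])

lemma continuous_on_alpha [continuous_intros]:
  assumes "continuous_on T f"
  shows "continuous_on T (\<lambda>x. alpha S (f x))"
proof -
  have "continuous_on UNIV (alpha S)"
    using alpha_has_vector_derivative
    by (intro continuous_at_imp_continuous_on ballI has_vector_derivative_continuous) blast
  then show ?thesis
    by (rule continuous_on_compose2[OF _ assms]) auto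
qed

lemma beta_eq: "beta S r = integral {0..r} (\<lambda>s. alpha S s ** Bc S)"
  by (simp add: beta_def alpha_def)

lemma gamma_eq_beta: "gamma S \<tau> \<theta> = beta S (\<theta> - \<tau>)"
  by (simp add: gamma_def beta_def)

lemma A_d_eq_alpha: "A_d S = alpha S (period S)"
  by (simp add: A_d_def alpha_def)

lemma B_d_eq_beta: "B_d S = beta S (period S)"
  by (simp add: B_d_def beta_def)

lemma Gam_eq_beta: "Gam S \<tau> = beta S (period S - \<tau>)"
  by (simp add: Gam_def beta_def)

lemma beta_nonpos [simp]: "r \<le> 0 \<Longrightarrow> beta S r = 0"
  by (cases "r = 0") (auto simp: beta_def)

lemma continuous_on_beta [continuous_intros]:
  assumes "continuous_on T f"
  shows "continuous_on T (\<lambda>x. beta S (f x))"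
proof -
  have "isCont (beta S) r" for r
  proof -
    define b where "b = \<bar>r\<bar> + 1"
    have "continuous_on {0..b} (beta S)"
      unfolding beta_eq[abs_def]
      by (intro indefinite_integral_continuous_1 integrable_continuous_interval continuous_intros)
    then have "continuous_on {..<b} (\<lambda>r. beta S (max 0 r))"
      by (rule continuous_on_compose2) (auto intro!: continuous_intros simp: b_def)
    moreover have "beta S (max 0 r) = beta S r" for r
      by (cases "r \<le> 0") auto
    ultimately have "continuous_on {..<b} (beta S)" by simp
    moreover have "r \<in> {..<b}" by (auto simp: b_def)
    ultimately show ?thesis
      using continuous_on_eq_continuous_at open_lessThan by blast
  qed
  then have "continuous_on UNIV (beta S)"
    by (simp add: continuous_at_imp_continuous_on)
  then show ?thesis
    by (rule continuous_on_compose2[OF _ assms]) auto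
qed

text \<open>The response to a unit step solves the differential equation, because integrating
  \<open>(d/ds) e\<^sup>A\<^sup>s B = A e\<^sup>A\<^sup>s B\<close> gives \<open>e\<^sup>A\<^sup>r B = A \<beta>(r) + B\<close>.\<close>

lemma beta_has_vector_derivative:
  assumes "r \<noteq> 0"
  shows "(beta S has_vector_derivative (Ac S ** beta S r + (if r > 0 then Bc S else 0))) (at r)"
proof (cases "r > 0")
  case True
  note bl = bounded_bilinear.bounded_linear_left[OF bounded_bilinear_matrix_matrix_mult, of "Bc S"]
  note bl' = bounded_bilinear.bounded_linear_right[OF bounded_bilinear_matrix_matrix_mult, of "Ac S"]
  have d: "((\<lambda>s. alpha S s ** Bc S) has_vector_derivative Ac S ** (alpha S s ** Bc S)) (at s)" for s
    using bounded_linear.has_vector_derivative[OF bl alpha_has_vector_derivative]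
    by (simp add: matrix_mul_assoc)
  have int: "(\<lambda>s. alpha S s ** Bc S) integrable_on {0..r}"
    by (intro integrable_continuous_interval continuous_intros)
  have "((\<lambda>s. Ac S ** (alpha S s ** Bc S)) has_integral (alpha S r ** Bc S - alpha S 0 ** Bc S)) {0..r}"
    using True by (intro fundamental_theorem_of_calculus has_vector_derivative_at_within[OF d]) auto
  moreover have "((\<lambda>s. Ac S ** (alpha S s ** Bc S)) has_integral Ac S ** beta S r) {0..r}"
    using has_integral_linear[OF integrable_integral[OF int] bl'] by (simp add: beta_eq o_def)
  ultimately have "alpha S r ** Bc S - Bc S = Ac S ** beta S r"
    by (metis (no_types) alpha_0 has_integral_unique matrix_mul_lid)
  then have eq: "alpha S r ** Bc S = Ac S ** beta S r + Bc S"
    by (simp add: algebra_simps)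
  have "(beta S has_vector_derivative alpha S r ** Bc S) (at r within {0..r + 1})"
    unfolding beta_eq[abs_def]
    using True by (intro integral_has_vector_derivative continuous_intros) auto
  moreover have "at r within {0..r + 1} = at r"
    using True by (intro at_within_interior) auto
  ultimately show ?thesis
    using True eq by simp
next
  case False
  then have "r < 0" using assms by simp
  have "((\<lambda>_. 0) has_vector_derivative 0) (at r)" by simp
  then have "(beta S has_vector_derivative 0) (at r)"
    by (rule has_vector_derivative_transform_within_open[where S = "{..<0}"])
       (use \<open>r < 0\<close> in auto)
  then show ?thesis using \<open>r < 0\<close> by (simp add: bounded_bilinear.zero_right[OF bounded_bilinear_matrix_matrix_mult])
qed

section \<open>The plant within one sampling period\<close>

text \<open>Uniqueness for the homogeneous equation: \<open>e\<^sup>-\<^sup>2\<^sup>K\<^sup>s |z(s)|\<^sup>2\<close> is nonincreasing when \<open>K\<close> bounds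
  the operator norm of \<open>X\<close>. The finite set \<open>E\<close> leaves room for the jumps of the input.\<close>

lemma linear_ode_zero:
  fixes z :: "real \<Rightarrow> real ^ 'n" and X :: "real ^ 'n ^ 'n"
  assumes cont: "continuous_on {0..T} z" and z0: "z 0 = 0" and E: "finite E"
    and deriv: "\<And>s. s \<in> {0<..<T} - E \<Longrightarrow> (z has_vector_derivative X *v z s) (at s)"
    and t: "t \<in> {0..T}"
  shows "z t = 0"
proof -
  obtain K where K: "\<And>v. norm (X *v v) \<le> norm v * K"
    using bounded_linear.bounded[OF matrix_vector_mul_bounded_linear[of X]] by blast
  define f where "f s = exp (-2 * K * s) * (z s \<bullet> z s)" for s
  define f' where "f' s = exp (-2 * K * s) * (2 * (z s \<bullet> (X *v z s)) - 2 * K * (z s \<bullet> z s))" for s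
  have "(f' has_integral (f t - f 0)) {0..t}"
  proof (rule fundamental_theorem_of_calculus_interior_strong[OF E])
    show "0 \<le> t" using t by simp
    show "continuous_on {0..t} f"
      unfolding f_def using t by (auto intro!: continuous_intros continuous_on_subset[OF cont])
    fix s assume s: "s \<in> {0<..<t} - E"
    have z: "(z has_vector_derivative X *v z s) (at s)"
      using s t by (intro deriv) auto
    have e: "((\<lambda>s. exp (-2 * K * s)) has_vector_derivative (-2 * K * exp (-2 * K * s))) (at s)"
      unfolding has_real_derivative_iff_has_vector_derivative[symmetric]
      by (auto intro!: derivative_eq_intros)
    show "(f has_vector_derivative f' s) (at s)"
      unfolding f_def f'_def
      by (rule has_vector_derivative_eq_rhs[OF has_vector_derivative_mult[OF e
             bounded_bilinear.has_vector_derivative[OF bounded_bilinear_inner z z]]])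
         (simp add: inner_commute algebra_simps)
  qed
  from has_integral_neg[OF this] have "((\<lambda>s. - f' s) has_integral (f 0 - f t)) {0..t}"
    by simp
  moreover have "0 \<le> - f' s" for s
  proof -
    have "z s \<bullet> (X *v z s) \<le> norm (z s) * norm (X *v z s)"
      by (rule norm_cauchy_schwarz)
    also have "\<dots> \<le> norm (z s) * (norm (z s) * K)"
      by (intro mult_left_mono K) simp
    also have "\<dots> = K * (z s \<bullet> z s)"
      by (simp add: power2_norm_eq_inner[symmetric] power2_eq_square)
    finally show ?thesis
      unfolding f'_def by (simp add: mult_le_0_iff)
  qed
  ultimately have "f t \<le> f 0"
    by (metis has_integral_nonneg diff_ge_0_iff_ge)
  then have "z t \<bullet> z t \<le> 0"
    by (simp add: f_def z0 mult_le_0_iff)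
  moreover have "0 \<le> z t \<bullet> z t" by simp
  ultimately show ?thesis by (metis inner_eq_zero_iff order_antisym)
qed

text \<open>The input \<open>u\<^sub>k\<^sub>-\<^sub>1\<close>, which is still active at time \<open>kh\<close>; for \<open>k = 0\<close> it is the initial value \<open>u\<^sub>-\<^sub>1\<close>.\<close>

definition prev_input :: "('n::finite, 'm::finite, 'w) sampled_system \<Rightarrow> ('m, 'w) control \<Rightarrow> nat \<Rightarrow> 'w \<Rightarrow> real ^ 'm" where
  "prev_input S u k \<omega> = (case k of 0 \<Rightarrow> u_init S \<omega> | Suc j \<Rightarrow> u j \<omega>)"

lemma prev_input_simps [simp]:
  "prev_input S u 0 \<omega> = u_init S \<omega>" "prev_input S u (Suc j) \<omega> = u j \<omega>"
  by (simp_all add: prev_input_def)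

lemma xi_eq: "xi S u k \<omega> = join_vec (plant_state S u (real k * period S) \<omega>) (prev_input S u k \<omega>)"
  by (simp add: xi_def prev_input_def)

text \<open>The claimed solution on one period, as a function of the time \<open>\<theta>\<close> elapsed in it: it starts in \<open>a\<close>, and
  the input switches from \<open>b\<close> to \<open>c\<close> at \<open>\<theta> = \<tau>\<close>.\<close>

definition intersample ::
  "('n::finite, 'm::finite, 'w) sampled_system \<Rightarrow> real \<Rightarrow> real ^ 'n \<Rightarrow> real ^ 'm \<Rightarrow> real ^ 'm \<Rightarrow> real \<Rightarrow> real ^ 'n" where
  "intersample S \<tau> a b c \<theta> = alpha S \<theta> *v a + (beta S \<theta> - gamma S \<tau> \<theta>) *v b + gamma S \<tau> \<theta> *v c"

lemma continuous_on_intersample [continuous_intros]: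
  "continuous_on T f \<Longrightarrow> continuous_on T (\<lambda>x. intersample S \<tau> a b c (f x))"
  unfolding intersample_def gamma_eq_beta by (intro continuous_intros)

lemma alpha_vec_has_vector_derivative:
  "((\<lambda>t. alpha S t *v a) has_vector_derivative Ac S *v (alpha S t *v a)) (at t)"
  using bounded_linear.has_vector_derivative[OF bounded_bilinear.bounded_linear_left[OF bounded_bilinear_matrix_vector_mult, of a] alpha_has_vector_derivative]
  by (simp add: matrix_vector_mul_assoc)

lemma has_vector_derivative_shift:
  "((\<lambda>t. t - s) has_vector_derivative 1) (at (t::real))"
  "((\<lambda>t. s + t) has_vector_derivative 1) (at t)"
  unfolding has_real_derivative_iff_has_vector_derivative[symmetric]
  by (auto intro!: derivative_eq_intros)

lemma beta_vec_has_vector_derivative: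
  assumes "t \<noteq> s"
  shows "((\<lambda>t. beta S (t - s) *v c) has_vector_derivative
      (Ac S *v (beta S (t - s) *v c) + (if s < t then Bc S *v c else 0))) (at t)"
proof -
  have "(beta S has_vector_derivative (Ac S ** beta S (t - s) + (if t - s > 0 then Bc S else 0))) (at (t - s))"
    using assms by (intro beta_has_vector_derivative) simp
  from vector_diff_chain_at[OF has_vector_derivative_shift(1) this]
  have "((\<lambda>t. beta S (t - s)) has_vector_derivative
      (Ac S ** beta S (t - s) + (if t - s > 0 then Bc S else 0))) (at t)"
    by (simp add: o_def)
  from bounded_linear.has_vector_derivative[OF bounded_bilinear.bounded_linear_left[OF bounded_bilinear_matrix_vector_mult, of c] this]
  show ?thesis
    by (auto simp: matrix_vector_mul_assoc matrix_vector_mult_add_rdistrib)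
qed

lemma intersample_has_vector_derivative:
  assumes "\<theta> > 0" "\<theta> \<noteq> \<tau>"
  shows "(intersample S \<tau> a b c has_vector_derivative
    (Ac S *v intersample S \<tau> a b c \<theta> + (Bc S *v (if \<theta> < \<tau> then b else c)))) (at \<theta>)"
proof -
  \<comment> \<open>The switch is a step of height \<open>c - b\<close> at time \<open>\<tau>\<close>, superposed on the constant input \<open>b\<close>.\<close>
  have *: "intersample S \<tau> a b c = (\<lambda>\<theta>. alpha S \<theta> *v a + beta S (\<theta> - 0) *v b + beta S (\<theta> - \<tau>) *v (c - b))"
    by (rule ext) (simp add: intersample_def gamma_eq_beta algebra_simps)
  have "((\<lambda>\<theta>. alpha S \<theta> *v a + beta S (\<theta> - 0) *v b + beta S (\<theta> - \<tau>) *v (c - b)) has_vector_derivative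
     Ac S *v (alpha S \<theta> *v a) +
     (Ac S *v (beta S (\<theta> - 0) *v b) + (if 0 < \<theta> then Bc S *v b else 0)) +
     (Ac S *v (beta S (\<theta> - \<tau>) *v (c - b)) + (if \<tau> < \<theta> then Bc S *v (c - b) else 0))) (at \<theta>)"
    using assms by (intro has_vector_derivative_add alpha_vec_has_vector_derivative beta_vec_has_vector_derivative) auto
  then show ?thesis
    unfolding * by (rule has_vector_derivative_eq_rhs) (use assms in \<open>auto simp: algebra_simps\<close>)
qed

locale sampled_LQ =
  fixes S :: "('n::finite, 'm::finite, 'w) sampled_system"
  assumes period_pos: "0 < period S" and lags_pos: "1 \<le> lags S"
    and tau_min_nonneg: "0 \<le> tau_min S" and tau_max_less: "tau_max S < period S"
    and Qc: "pos_semidef (Qc S)" and Rc: "pos_def (Rc S)"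
    and delays: "markov_delays S"
begin

lemma measurable_phi: "phi S k \<in> sample S \<rightarrow>\<^sub>M delay_space S"
  using delays by (simp add: markov_delays_def)

lemma phi_0: "phi S k \<omega> 0 = delay S (int k) \<omega>"
  using lags_pos by (simp add: phi_def)

lemma delay_space_0:
  assumes "\<phi> \<in> space (delay_space S)"
  shows "0 \<le> \<phi> 0" "\<phi> 0 < period S"
proof -
  have "\<phi> 0 \<in> {tau_min S..tau_max S}"
    using PiE_mem[OF assms[unfolded delay_space_def space_PiM], of 0] lags_pos
    by (simp add: space_restrict_space)
  then show "0 \<le> \<phi> 0" "\<phi> 0 < period S"
    using tau_min_nonneg tau_max_less by auto
qed

lemma delay_bounds:
  assumes "\<omega> \<in> space (sample S)"
  shows "0 \<le> delay S (int k) \<omega>" "delay S (int k) \<omega> < period S"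
  using delay_space_0[OF measurable_space[OF measurable_phi[of k] assms]] by (auto simp: phi_0)

text \<open>Because every delay is shorter than a period, the \<open>k\<close>-th switch falls into the \<open>k\<close>-th
  period; in particular the switching times are strictly increasing and each period contains exactly one.\<close>

lemma switch_time_bounds:
  assumes "\<omega> \<in> space (sample S)"
  shows "real k * period S \<le> switch_time S \<omega> k" "switch_time S \<omega> k < real (Suc k) * period S"
  using delay_bounds[OF assms, of k] by (auto simp: switch_time_def algebra_simps)

lemma switch_time_strict_mono:
  assumes "\<omega> \<in> space (sample S)"
  shows "strict_mono (switch_time S \<omega>)"
  unfolding strict_mono_Suc_iff
  using switch_time_bounds[OF assms] by (meson less_le_trans)

lemma plant_input_before: "t < switch_time S \<omega> 0 \<Longrightarrow> plant_input S u t \<omega> = u_init S \<omega>"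
  by (simp add: plant_input_def switch_time_def)

lemma plant_input_between:
  assumes \<omega>: "\<omega> \<in> space (sample S)" and t: "switch_time S \<omega> k \<le> t" "t < switch_time S \<omega> (Suc k)"
  shows "plant_input S u t \<omega> = u k \<omega>"
proof -
  note mono = switch_time_strict_mono[OF \<omega>]
  have "(THE k. switch_time S \<omega> k \<le> t \<and> t < switch_time S \<omega> (Suc k)) = k"
  proof (rule the_equality)
    fix j assume j: "switch_time S \<omega> j \<le> t \<and> t < switch_time S \<omega> (Suc j)"
    then have "switch_time S \<omega> j < switch_time S \<omega> (Suc k)" "switch_time S \<omega> k < switch_time S \<omega> (Suc j)"
      using t by auto
    then show "j = k"
      using strict_mono_less[OF mono] by auto
  qed (use t in auto)
  moreover have "switch_time S \<omega> 0 \<le> switch_time S \<omega> k"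
    using strict_mono_less_eq[OF mono] by simp
  then have "\<not> t < delay S 0 \<omega>"
    using t by (simp add: switch_time_def)
  ultimately show ?thesis by (simp add: plant_input_def)
qed

lemma plant_input_within_period:
  assumes \<omega>: "\<omega> \<in> space (sample S)" and \<theta>: "0 \<le> \<theta>" "\<theta> < period S"
  shows "plant_input S u (real k * period S + \<theta>) \<omega> =
    (if \<theta> < delay S (int k) \<omega> then prev_input S u k \<omega> else u k \<omega>)"
proof (cases "\<theta> < delay S (int k) \<omega>")
  case True
  then have lt: "real k * period S + \<theta> < switch_time S \<omega> k"
    by (simp add: switch_time_def)
  show ?thesis
  proof (cases k)
    case 0
    then show ?thesis using lt True plant_input_before by simp
  next
    case (Suc j)
    then have "switch_time S \<omega> j \<le> real k * period S + \<theta>"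
      using switch_time_bounds(2)[OF \<omega>, of j] \<theta> by simp
    then show ?thesis using lt True plant_input_between[OF \<omega>, of j] Suc by simp
  qed
next
  case False
  then have "switch_time S \<omega> k \<le> real k * period S + \<theta>"
    by (simp add: switch_time_def)
  moreover have "real k * period S + \<theta> < switch_time S \<omega> (Suc k)"
    using switch_time_bounds(1)[OF \<omega>, of "Suc k"] \<theta> by (simp add: algebra_simps)
  ultimately show ?thesis using False plant_input_between[OF \<omega>] by simp
qed

text \<open>The jumps \<open>u\<^sub>k - u\<^sub>k\<^sub>-\<^sub>1\<close> that occurred before \<open>t\<close> telescope to the active input.\<close>

lemma plant_input_sum_of_jumps:
  assumes \<omega>: "\<omega> \<in> space (sample S)" and t: "t \<notin> range (switch_time S \<omega>)" "t < switch_time S \<omega> (Suc N)"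
  shows "u_init S \<omega> + (\<Sum>k\<le>N. if switch_time S \<omega> k < t then u k \<omega> - prev_input S u k \<omega> else 0)
    = plant_input S u t \<omega>"
  using t(2)
proof (induction N)
  case 0
  show ?case
  proof (cases "t < switch_time S \<omega> 0")
    case True
    then show ?thesis by (simp add: plant_input_before)
  next
    case False
    moreover have "t \<noteq> switch_time S \<omega> 0" using t(1) by auto
    ultimately show ?thesis using 0 plant_input_between[OF \<omega>, of 0 t] by simp
  qed
next
  case (Suc N)
  have telescope: "u_init S \<omega> + (\<Sum>k\<le>M. u k \<omega> - prev_input S u k \<omega>) = u M \<omega>" for M
    by (induction M) (auto simp: algebra_simps)
  show ?case
  proof (cases "t < switch_time S \<omega> (Suc N)")
    case True
    then show ?thesis using Suc.IH by simp
  next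
    case False
    moreover have "t \<noteq> switch_time S \<omega> (Suc N)" using t(1) by auto
    ultimately have "switch_time S \<omega> (Suc N) < t" by simp
    then have "switch_time S \<omega> k < t" if "k \<le> Suc N" for k
      using strict_mono_less_eq[OF switch_time_strict_mono[OF \<omega>], of k "Suc N"] that by linarith
    then have "(\<Sum>k\<le>Suc N. if switch_time S \<omega> k < t then u k \<omega> - prev_input S u k \<omega> else 0)
       = (\<Sum>k\<le>Suc N. u k \<omega> - prev_input S u k \<omega>)"
      by (intro sum.cong) auto
    then show ?thesis
      using telescope[of "Suc N"] False Suc.prems plant_input_between[OF \<omega>, of "Suc N" t] by simp
  qed
qed

text \<open>By superposition the solution is the free motion plus one step response for the initial input and
  for each jump of the input. Up to time \<open>Nh\<close> only the first \<open>N\<close> jumps contribute, so the infinite sum is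
  locally finite; \<open>y N\<close> is a truncation that is exact there.\<close>

lemma plant_trajectory_exists:
  assumes \<omega>: "\<omega> \<in> space (sample S)"
  shows "\<exists>x. plant_trajectory S u \<omega> x"
proof -
  \<comment> \<open>The initial input is a step at time 0; the form \<open>t - 0\<close> gives all steps the same shape.\<close>
  define y where "y N t = alpha S t *v x_init S \<omega> + beta S (t - 0) *v u_init S \<omega>
      + (\<Sum>k\<le>N. beta S (t - switch_time S \<omega> k) *v (u k \<omega> - prev_input S u k \<omega>))" for N :: nat and t
  define x where "x t = y (nat \<lceil>t / period S\<rceil>) t" for t
  have mono: "y N t = y M t" if "t \<le> real N * period S" "N \<le> M" for N M t
  proof -
    have "beta S (t - switch_time S \<omega> k) = 0" if "k > N" for k
    proof (rule beta_nonpos)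
      have "real N * period S \<le> real k * period S"
        using that period_pos by simp
      then show "t - switch_time S \<omega> k \<le> 0"
        using switch_time_bounds(1)[OF \<omega>, of k] \<open>t \<le> real N * period S\<close> by linarith
    qed
    then have "(\<Sum>k\<le>N. beta S (t - switch_time S \<omega> k) *v (u k \<omega> - prev_input S u k \<omega>))
        = (\<Sum>k\<le>M. beta S (t - switch_time S \<omega> k) *v (u k \<omega> - prev_input S u k \<omega>))"
      using that(2) by (intro sum.mono_neutral_left) auto
    then show ?thesis
      unfolding y_def by simp
  qed
  have x_eq: "x t = y N t" if "t \<le> real N * period S" for N t
  proof -
    have "t / period S \<le> real N" using that period_pos by (simp add: field_simps)
    then have "nat \<lceil>t / period S\<rceil> \<le> N" by (simp add: ceiling_le_iff)
    moreover have "t / period S \<le> real (nat \<lceil>t / period S\<rceil>)" by (rule real_nat_ceiling_ge)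
    then have "t \<le> real (nat \<lceil>t / period S\<rceil>) * period S" using period_pos by (simp add: field_simps)
    ultimately show ?thesis unfolding x_def using mono by blast
  qed
  have beyond: "\<exists>N. t < real N * period S" for t
    using period_pos reals_Archimedean3 by blast
  have "isCont x t" for t
  proof -
    obtain N where N: "t < real N * period S" using beyond by blast
    have "eventually (\<lambda>s. s \<in> {..<real N * period S}) (nhds t)"
      using N by (intro eventually_nhds_in_open) auto
    then have "eventually (\<lambda>s. x s = y N s) (nhds t)"
      by eventually_elim (simp add: x_eq)
    moreover have "isCont (y N) t"
      unfolding y_def
      by (intro continuous_on_interior[where S = UNIV] continuous_intros) auto
    ultimately show ?thesis using isCont_cong by blast
  qed
  then have "continuous_on {0..} x" by (simp add: continuous_at_imp_continuous_on)
  moreover have "x 0 = x_init S \<omega>"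
  proof -
    have "x 0 = y 0 0" by (rule x_eq) simp
    also have "\<dots> = x_init S \<omega>"
      using switch_time_bounds(1)[OF \<omega>, of 0] by (simp add: y_def)
    finally show ?thesis .
  qed
  moreover have "(x has_vector_derivative (Ac S *v x t + Bc S *v plant_input S u t \<omega>)) (at t)"
    if t: "t > 0" "t \<notin> range (switch_time S \<omega>)" for t
  proof -
    obtain N where N: "t < real N * period S" using beyond by blast
    have ne: "t \<noteq> switch_time S \<omega> k" for k using t by auto
    have "real N * period S \<le> real (Suc N) * period S" using period_pos by simp
    then have tN: "t < switch_time S \<omega> (Suc N)"
      using N switch_time_bounds(1)[OF \<omega>, of "Suc N"] by linarith
    have "(y N has_vector_derivative
      Ac S *v (alpha S t *v x_init S \<omega>) +
      (Ac S *v (beta S (t - 0) *v u_init S \<omega>) + (if 0 < t then Bc S *v u_init S \<omega> else 0)) +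
      (\<Sum>k\<le>N. Ac S *v (beta S (t - switch_time S \<omega> k) *v (u k \<omega> - prev_input S u k \<omega>))
         + (if switch_time S \<omega> k < t then Bc S *v (u k \<omega> - prev_input S u k \<omega>) else 0))) (at t)"
      unfolding y_def using t ne
      by (intro has_vector_derivative_add has_vector_derivative_sum alpha_vec_has_vector_derivative
           beta_vec_has_vector_derivative) auto
    also have "Ac S *v (alpha S t *v x_init S \<omega>) +
      (Ac S *v (beta S (t - 0) *v u_init S \<omega>) + (if 0 < t then Bc S *v u_init S \<omega> else 0)) +
      (\<Sum>k\<le>N. Ac S *v (beta S (t - switch_time S \<omega> k) *v (u k \<omega> - prev_input S u k \<omega>))
         + (if switch_time S \<omega> k < t then Bc S *v (u k \<omega> - prev_input S u k \<omega>) else 0))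
      = Ac S *v y N t + Bc S *v (u_init S \<omega> +
         (\<Sum>k\<le>N. if switch_time S \<omega> k < t then u k \<omega> - prev_input S u k \<omega> else 0))"
    proof -
      have "Bc S *v (\<Sum>k\<le>N. if switch_time S \<omega> k < t then u k \<omega> - prev_input S u k \<omega> else 0)
        = (\<Sum>k\<le>N. if switch_time S \<omega> k < t then Bc S *v (u k \<omega> - prev_input S u k \<omega>) else 0)"
        by (simp add: linear_sum[OF matrix_vector_mul_linear] if_distrib cong: if_cong)
      then show ?thesis
        using t by (simp add: y_def matrix_vector_right_distrib linear_sum[OF matrix_vector_mul_linear] sum.distrib)
    qed
    also have "\<dots> = Ac S *v x t + Bc S *v plant_input S u t \<omega>"
      using plant_input_sum_of_jumps[OF \<omega> t(2) tN] x_eq[of t N] N by simp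
    finally have "(y N has_vector_derivative (Ac S *v x t + Bc S *v plant_input S u t \<omega>)) (at t)" .
    then show ?thesis
      by (rule has_vector_derivative_transform_within_open[where S = "{..<real N * period S}"])
         (use N x_eq[of _ N] in auto)
  qed
  ultimately show ?thesis unfolding plant_trajectory_def by blast
qed

lemma plant_state_trajectory:
  assumes "\<omega> \<in> space (sample S)"
  shows "plant_trajectory S u \<omega> (\<lambda>t. plant_state S u t \<omega>)"
  unfolding plant_state_def using someI_ex[OF plant_trajectory_exists[OF assms]] by simp

lemma plant_state_0: "\<omega> \<in> space (sample S) \<Longrightarrow> plant_state S u 0 \<omega> = x_init S \<omega>"
  using plant_state_trajectory by (simp add: plant_trajectory_def)

text \<open>Both sides solve the same equation on the period and start in the same point, so their difference
  solves the homogeneous equation with initial value zero. Only the defining properties of a trajectory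
  enter, so the formula holds for whichever trajectory the choice operator picks.\<close>

lemma plant_state_within_period:
  assumes \<omega>: "\<omega> \<in> space (sample S)" and \<theta>: "\<theta> \<in> {0..period S}"
  shows "plant_state S u (real k * period S + \<theta>) \<omega> =
    intersample S (delay S (int k) \<omega>) (plant_state S u (real k * period S) \<omega>)
      (prev_input S u k \<omega>) (u k \<omega>) \<theta>"
proof -
  let ?t = "\<lambda>\<theta>. real k * period S + \<theta>" and ?\<tau> = "delay S (int k) \<omega>"
  let ?f = "intersample S ?\<tau> (plant_state S u (?t 0) \<omega>) (prev_input S u k \<omega>) (u k \<omega>)"
  define z where "z \<theta> = plant_state S u (?t \<theta>) \<omega> - ?f \<theta>" for \<theta>
  have traj: "continuous_on {0..} (\<lambda>t. plant_state S u t \<omega>)"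
    "\<And>t. t > 0 \<Longrightarrow> t \<notin> range (switch_time S \<omega>) \<Longrightarrow>
      ((\<lambda>t. plant_state S u t \<omega>) has_vector_derivative
        (Ac S *v plant_state S u t \<omega> + Bc S *v plant_input S u t \<omega>)) (at t)"
    using plant_state_trajectory[OF \<omega>, of u] by (auto simp: plant_trajectory_def)
  have "z \<theta> = 0"
  proof (rule linear_ode_zero[where E = "{?\<tau>}" and X = "Ac S"])
    have "continuous_on {0..period S} (\<lambda>\<theta>. plant_state S u (?t \<theta>) \<omega>)"
      by (rule continuous_on_compose2[OF traj(1)]) (use period_pos in \<open>auto intro!: continuous_intros\<close>)
    then show "continuous_on {0..period S} z"
      unfolding z_def by (intro continuous_intros)
    show "z 0 = 0"
      using delay_bounds[OF \<omega>, of k] by (simp add: z_def intersample_def gamma_eq_beta)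
    fix s assume s: "s \<in> {0<..<period S} - {?\<tau>}"
    have "?t s \<noteq> switch_time S \<omega> j" for j
    proof -
      consider "j = k" | "Suc j \<le> k" | "Suc k \<le> j" by linarith
      then show ?thesis
      proof cases
        case 1 then show ?thesis using s by (auto simp: switch_time_def)
      next
        case 2
        then have "real (Suc j) * period S \<le> real k * period S"
          using period_pos by simp
        then show ?thesis using switch_time_bounds(2)[OF \<omega>, of j] s by (smt (verit) Diff_iff greaterThanLessThan_iff)
      next
        case 3
        then have "real (Suc k) * period S \<le> real j * period S"
          using period_pos by (intro mult_right_mono) auto
        then show ?thesis using switch_time_bounds(1)[OF \<omega>, of j] s by (auto simp: algebra_simps)
      qed
    qed
    then have "((\<lambda>t. plant_state S u t \<omega>) has_vector_derivative
        (Ac S *v plant_state S u (?t s) \<omega> + Bc S *v plant_input S u (?t s) \<omega>)) (at (?t s))"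
      using s period_pos by (intro traj(2)) (auto intro!: add_nonneg_pos)
    from vector_diff_chain_at[OF has_vector_derivative_shift(2) this]
    have "((\<lambda>s. plant_state S u (?t s) \<omega>) has_vector_derivative
        (Ac S *v plant_state S u (?t s) \<omega> + Bc S *v plant_input S u (?t s) \<omega>)) (at s)"
      by (simp add: o_def)
    moreover have "(?f has_vector_derivative
        (Ac S *v ?f s + Bc S *v (if s < ?\<tau> then prev_input S u k \<omega> else u k \<omega>))) (at s)"
      using s by (intro intersample_has_vector_derivative) auto
    ultimately show "(z has_vector_derivative Ac S *v z s) (at s)"
      unfolding z_def
      by (rule has_vector_derivative_eq_rhs[OF has_vector_derivative_diff])
         (use s in \<open>auto simp: plant_input_within_period[OF \<omega>] matrix_vector_mult_diff_distrib\<close>)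
  qed (use \<theta> in simp_all)
  then show ?thesis by (simp add: z_def)
qed

lemma xi_0: "\<omega> \<in> space (sample S) \<Longrightarrow> xi S u 0 \<omega> = xi_init S \<omega>"
  by (simp add: xi_eq xi_init_def plant_state_0)

lemma xi_Suc:
  assumes \<omega>: "\<omega> \<in> space (sample S)"
  shows "xi S u (Suc k) \<omega> = A_mat S (phi S k \<omega>) *v xi S u k \<omega> + B_mat S (phi S k \<omega>) *v u k \<omega>"
proof -
  have "plant_state S u (real (Suc k) * period S) \<omega> = plant_state S u (real k * period S + period S) \<omega>"
    by (simp add: algebra_simps)
  also have "\<dots> = intersample S (delay S (int k) \<omega>) (plant_state S u (real k * period S) \<omega>)
      (prev_input S u k \<omega>) (u k \<omega>) (period S)"
    using period_pos by (intro plant_state_within_period[OF \<omega>]) auto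
  finally show ?thesis
    unfolding xi_eq A_mat_def B_mat_def block_mat_mult_join stack_mat_mult_vec join_vec_add
    by (simp add: phi_0 intersample_def A_d_eq_alpha B_d_eq_beta Gam_eq_beta gamma_eq_beta)
qed

end

section \<open>The cost of one sampling period\<close>

lemma has_integral_bilinear_form:
  fixes M :: "real \<Rightarrow> real ^ 'b ^ 'a"
  assumes "continuous_on {c..d} M"
  shows "((\<lambda>\<theta>. v \<bullet> (M \<theta> *v w)) has_integral v \<bullet> (integral {c..d} M *v w)) {c..d}"
proof -
  have "bounded_linear (\<lambda>M :: real ^ 'b ^ 'a. v \<bullet> (M *v w))"
    by (rule bounded_linear_compose[OF bounded_linear_inner_right
          bounded_bilinear.bounded_linear_left[OF bounded_bilinear_matrix_vector_mult]])
  from has_integral_linear[OF integrable_integral[OF integrable_continuous_interval[OF assms]] this]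
  show ?thesis by (simp add: o_def)
qed

lemma integral_extend_by_zero:
  fixes f :: "real \<Rightarrow> 'a::banach"
  assumes "a \<le> c" "c \<le> b" "continuous_on {a..b} f" "\<And>x. x \<le> c \<Longrightarrow> f x = 0"
  shows "integral {c..b} f = integral {a..b} f"
proof -
  have "integral {a..c} f = 0"
    using assms(4) by (intro integral_unique has_integral_is_0) auto
  then show ?thesis
    using Henstock_Kurzweil_Integration.integral_combine[OF assms(1,2) integrable_continuous_interval[OF assms(3)]] by simp
qed

lemma congruence_form:
  fixes X :: "real ^ 'a ^ 'n" and Y :: "real ^ 'b ^ 'n" and Q :: "real ^ 'n ^ 'n"
  shows "v \<bullet> ((transpose X ** Q ** Y) *v w) = (X *v v) \<bullet> (Q *v (Y *v w))"
  by (simp add: inner_matrix_transpose matrix_vector_mul_assoc matrix_mul_assoc)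

lemma pos_def_invertible:
  fixes R :: "real ^ 'n ^ 'n"
  assumes "pos_def R"
  shows "invertible R"
proof -
  have "v = 0" if "R *v v = 0" for v
    using assms that by (auto simp: pos_def_def dest: spec[of _ v])
  then show ?thesis
    by (simp add: invertible_left_inverse matrix_left_invertible_ker)
qed

lemma complete_the_square:
  fixes Q :: "real ^ 'z ^ 'z" and W :: "real ^ 'm ^ 'z" and R :: "real ^ 'm ^ 'm"
  assumes "invertible R" and "transpose R = R"
  defines "K \<equiv> matrix_inv R ** transpose W"
  shows "\<zeta> \<bullet> (Q *v \<zeta>) + 2 * (\<zeta> \<bullet> (W *v c)) + c \<bullet> (R *v c)
    = \<zeta> \<bullet> ((Q - W ** matrix_inv R ** transpose W) *v \<zeta>) + (c + K *v \<zeta>) \<bullet> (R *v (c + K *v \<zeta>))"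
proof -
  define y where "y = K *v \<zeta>"
  have Ry: "R *v y = transpose W *v \<zeta>"
    unfolding y_def K_def
    by (simp add: matrix_vector_mul_assoc matrix_mul_assoc matrix_inv_inverse(1)[OF assms(1)])
  have W: "\<zeta> \<bullet> (W *v v) = (R *v y) \<bullet> v" for v
    unfolding Ry by (metis inner_commute inner_matrix_transpose)
  have "(W ** matrix_inv R ** transpose W) *v \<zeta> = W *v y"
    by (simp add: y_def K_def matrix_vector_mul_assoc matrix_mul_assoc)
  moreover have "y \<bullet> (R *v c) = (R *v y) \<bullet> c"
    by (simp add: inner_matrix_transpose assms(2))
  ultimately show ?thesis
    unfolding y_def[symmetric]
    by (simp add: matrix_vector_mult_diff_rdistrib matrix_vector_right_distrib inner_add_left
        inner_add_right inner_diff_right W inner_commute)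
qed

context sampled_LQ
begin

lemma transpose_Qc [simp]: "transpose (Qc S) = Qc S" and transpose_Rc [simp]: "transpose (Rc S) = Rc S"
  using Qc Rc by (auto simp: pos_semidef_def pos_def_def)

lemma Qc_nonneg: "0 \<le> v \<bullet> (Qc S *v v)"
  using Qc by (simp add: pos_semidef_def)

lemma Rc_nonneg: "0 \<le> v \<bullet> (Rc S *v v)"
  using Rc by (cases "v = 0") (auto simp: pos_def_def less_imp_le)

lemma Qc_commute: "v \<bullet> (Qc S *v w) = w \<bullet> (Qc S *v v)"
  by (metis inner_commute inner_matrix_transpose transpose_Qc)

text \<open>Integrals over \<open>[\<tau>, h]\<close> whose integrand contains the factor \<open>\<gamma>(\<tau>, \<theta>)\<close>, which vanishes for
  \<open>\<theta> \<le> \<tau>\<close>, may be taken over the whole period. Then all integrals have a domain that does not depend on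
  \<open>\<tau>\<close>: this yields continuity in \<open>\<tau>\<close> and lets the terms of the cost be added under one integral.\<close>

lemma integral_from_delay:
  assumes "0 \<le> \<tau>" "\<tau> < period S" "continuous_on UNIV F" "\<And>\<theta>. \<theta> \<le> \<tau> \<Longrightarrow> F \<theta> = (0 :: real ^ 'a ^ 'b)"
  shows "integral {\<tau>..period S} F = integral {0..period S} F"
  using assms by (intro integral_extend_by_zero) (auto intro: continuous_on_subset)

lemma transpose_R_mat: "transpose (R_mat S \<phi>) = R_mat S \<phi>"
proof -
  let ?M = "\<lambda>\<theta>. transpose (gamma S (\<phi> 0) \<theta>) ** Qc S ** gamma S (\<phi> 0) \<theta>"
  have "?M integrable_on {\<phi> 0..period S}"
    unfolding gamma_eq_beta by (intro integrable_continuous_interval continuous_intros)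
  from integral_linear[OF this bounded_linear_transpose]
  have "transpose (integral {\<phi> 0..period S} ?M) = integral {\<phi> 0..period S} ?M"
    by (simp add: o_def matrix_transpose_mul matrix_mul_assoc)
  then show ?thesis
    unfolding R_mat_def
    by (simp add: linear_add[OF bounded_linear.linear[OF bounded_linear_transpose]]
        linear_scale[OF bounded_linear.linear[OF bounded_linear_transpose]])
qed

lemma R_mat_pos_def:
  assumes "\<phi> 0 < period S"
  shows "pos_def (R_mat S \<phi>)"
  unfolding pos_def_def
proof (intro conjI allI impI transpose_R_mat)
  fix v :: "real ^ 'm" assume "v \<noteq> 0"
  let ?M = "\<lambda>\<theta>. transpose (gamma S (\<phi> 0) \<theta>) ** Qc S ** gamma S (\<phi> 0) \<theta>"
  have "((\<lambda>\<theta>. v \<bullet> (?M \<theta> *v v)) has_integral v \<bullet> (integral {\<phi> 0..period S} ?M *v v)) {\<phi> 0..period S}"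
    unfolding gamma_eq_beta by (intro has_integral_bilinear_form continuous_intros)
  then have "0 \<le> v \<bullet> (integral {\<phi> 0..period S} ?M *v v)"
    by (rule has_integral_nonneg) (simp add: congruence_form Qc_nonneg)
  moreover have "0 < (period S - \<phi> 0) * (v \<bullet> (Rc S *v v))"
    using assms Rc \<open>v \<noteq> 0\<close> by (simp add: pos_def_def)
  ultimately show "0 < v \<bullet> (R_mat S \<phi> *v v)"
    unfolding R_mat_def
    by (simp add: matrix_vector_mult_add_rdistrib inner_add_right scaleR_matrix_vector_assoc[symmetric])
qed

lemma R_mat_invertible: "\<phi> \<in> space (delay_space S) \<Longrightarrow> invertible (R_mat S \<phi>)"
  using R_mat_pos_def delay_space_0 pos_def_invertible by blast

lemma continuous_on_integral_from_delay:
  fixes F :: "real \<Rightarrow> real \<Rightarrow> real ^ 'a ^ 'b"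
  assumes cont: "continuous_on UNIV (\<lambda>z. F (fst z) (snd z))" and zero: "\<And>\<tau> \<theta>. \<theta> \<le> \<tau> \<Longrightarrow> F \<tau> \<theta> = 0"
  shows "continuous_on {0..<period S} (\<lambda>\<tau>. integral {\<tau>..period S} (F \<tau>))"
proof -
  have F: "continuous_on UNIV (F \<tau>)" for \<tau>
    using continuous_on_compose2[OF cont continuous_on_Pair[OF continuous_on_const continuous_on_id]]
    by simp
  have "continuous_on {0..<period S} (\<lambda>\<tau>. integral (cbox 0 (period S)) (F \<tau>))"
    by (rule integral_continuous_on_param)
       (use cont in \<open>auto simp: split_beta intro: continuous_on_subset\<close>)
  then show ?thesis
    by (rule continuous_on_eq) (use zero in \<open>auto intro!: integral_from_delay[symmetric] F\<close>)
qed

lemma continuous_on_A_mat: "continuous_on {0..<period S} (\<lambda>\<tau>. A_mat S (\<lambda>_. \<tau>))"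
  unfolding A_mat_def Gam_eq_beta by (intro continuous_intros)

lemma continuous_on_B_mat: "continuous_on {0..<period S} (\<lambda>\<tau>. B_mat S (\<lambda>_. \<tau>))"
  unfolding B_mat_def Gam_eq_beta by (intro continuous_intros)

lemma zero_matrix_mult: "0 ** (X :: real ^ 'c ^ 'b) = (0 :: real ^ 'c ^ 'a)" "(Y :: real ^ 'b ^ 'a) ** 0 = (0 :: real ^ 'c ^ 'a)"
  by (simp_all add: matrix_matrix_mult_def vec_eq_iff)

lemma transpose_zero: "transpose (0 :: real ^ 'b ^ 'a) = 0"
  by (simp add: transpose_def vec_eq_iff)

lemma stack_mat_zero: "stack_mat 0 0 = (0 :: real ^ 'c ^ ('a::finite + 'b::finite))"
  unfolding stack_mat_def by (auto simp: vec_eq_iff split: sum.split)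

lemma continuous_on_R_mat: "continuous_on {0..<period S} (\<lambda>\<tau>. R_mat S (\<lambda>_. \<tau>))"
  unfolding R_mat_def gamma_eq_beta
  by (intro continuous_intros continuous_on_integral_from_delay)
     (auto simp: zero_matrix_mult transpose_zero)

lemma continuous_on_W_mat: "continuous_on {0..<period S} (\<lambda>\<tau>. W_mat S (\<lambda>_. \<tau>))"
  unfolding W_mat_def gamma_eq_beta
  by (intro continuous_on_integral_from_delay continuous_intros)
     (auto simp: zero_matrix_mult transpose_zero stack_mat_zero)

lemma continuous_on_Q_mat: "continuous_on {0..<period S} (\<lambda>\<tau>. Q_mat S (\<lambda>_. \<tau>))"
proof -
  have Q12: "continuous_on {0..<period S} (Q12 S)"
    unfolding Q12_def gamma_eq_beta
    by (intro continuous_intros continuous_on_integral_from_delay)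
       (auto simp: zero_matrix_mult transpose_zero)
  have Q22: "continuous_on {0..<period S} (Q22 S)"
    unfolding Q22_def gamma_eq_beta
    by (intro continuous_intros continuous_on_integral_from_delay)
       (auto simp: zero_matrix_mult transpose_zero)
  show ?thesis
    unfolding Q_mat_def Q11_def by (intro continuous_intros Q12 Q22)
qed

text \<open>Write the state as \<open>\<alpha> a + \<beta> b - \<gamma> d\<close> with \<open>d = b - c\<close> and expand the square. The six kinds of
  products integrate to the forms \<open>Iaa\<close> to \<open>Igg\<close>; the blocks of \<open>Q\<close>, \<open>W\<close>, \<open>R\<close> are the combinations of
  these that belong to the pairs of \<open>a\<close>, \<open>b\<close>, \<open>c\<close>. The input contributes \<open>R\<^sub>c\<close> weighted by the lengths
  \<open>\<tau>\<close> and \<open>h - \<tau>\<close> of the two phases.\<close>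

lemma period_cost:
  fixes a :: "real ^ 'n" and b c :: "real ^ 'm"
  assumes \<tau>: "0 \<le> \<phi> 0" "\<phi> 0 < period S"
  defines "\<zeta> \<equiv> join_vec a b"
    and "x \<equiv> intersample S (\<phi> 0) a b c" and "w \<equiv> (\<lambda>\<theta>. if \<theta> < \<phi> 0 then b else c)"
  shows "((\<lambda>\<theta>. x \<theta> \<bullet> (Qc S *v x \<theta>) + w \<theta> \<bullet> (Rc S *v w \<theta>)) has_integral
    \<zeta> \<bullet> (Q_mat S \<phi> *v \<zeta>) + 2 * (\<zeta> \<bullet> (W_mat S \<phi> *v c)) + c \<bullet> (R_mat S \<phi> *v c)) {0..period S}"
proof -
  let ?h = "period S" and ?\<tau> = "\<phi> 0"
  let ?\<alpha> = "alpha S" and ?\<beta> = "beta S" and ?\<gamma> = "gamma S (\<phi> 0)"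
  let ?I = "\<lambda>F. integral {0..period S} F"
  note cont = continuous_on_alpha continuous_on_beta continuous_intros
  note zero = zero_matrix_mult transpose_zero
  define d where "d = b - c"
  define Iaa where "Iaa = ?I (\<lambda>\<theta>. transpose (?\<alpha> \<theta>) ** Qc S ** ?\<alpha> \<theta>)"
  define Iab where "Iab = ?I (\<lambda>\<theta>. transpose (?\<alpha> \<theta>) ** Qc S ** ?\<beta> \<theta>)"
  define Ibb where "Ibb = ?I (\<lambda>\<theta>. transpose (?\<beta> \<theta>) ** Qc S ** ?\<beta> \<theta>)"
  define Iag where "Iag = ?I (\<lambda>\<theta>. transpose (?\<alpha> \<theta>) ** Qc S ** ?\<gamma> \<theta>)"
  define Ibg where "Ibg = ?I (\<lambda>\<theta>. transpose (?\<beta> \<theta>) ** Qc S ** ?\<gamma> \<theta>)"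
  define Igg where "Igg = ?I (\<lambda>\<theta>. transpose (?\<gamma> \<theta>) ** Qc S ** ?\<gamma> \<theta>)"
  have form: "((\<lambda>\<theta>. (?\<alpha> \<theta> *v v1) \<bullet> (Qc S *v (?\<alpha> \<theta> *v v2))) has_integral v1 \<bullet> (Iaa *v v2)) {0..?h}"
    "((\<lambda>\<theta>. (?\<alpha> \<theta> *v v1) \<bullet> (Qc S *v (?\<beta> \<theta> *v w2))) has_integral v1 \<bullet> (Iab *v w2)) {0..?h}"
    "((\<lambda>\<theta>. (?\<beta> \<theta> *v w1) \<bullet> (Qc S *v (?\<beta> \<theta> *v w2))) has_integral w1 \<bullet> (Ibb *v w2)) {0..?h}"
    "((\<lambda>\<theta>. (?\<alpha> \<theta> *v v1) \<bullet> (Qc S *v (?\<gamma> \<theta> *v w2))) has_integral v1 \<bullet> (Iag *v w2)) {0..?h}"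
    "((\<lambda>\<theta>. (?\<beta> \<theta> *v w1) \<bullet> (Qc S *v (?\<gamma> \<theta> *v w2))) has_integral w1 \<bullet> (Ibg *v w2)) {0..?h}"
    "((\<lambda>\<theta>. (?\<gamma> \<theta> *v w1) \<bullet> (Qc S *v (?\<gamma> \<theta> *v w2))) has_integral w1 \<bullet> (Igg *v w2)) {0..?h}"
    for v1 v2 w1 w2
    unfolding Iaa_def Iab_def Ibb_def Iag_def Ibg_def Igg_def congruence_form[symmetric] gamma_eq_beta
    by (intro has_integral_bilinear_form cont)+
  have Q12: "Q12 S ?\<tau> = Iab - Iag"
    unfolding Q12_def Iab_def Iag_def gamma_eq_beta using \<tau>
    by (subst integral_from_delay) (auto intro!: cont simp: zero)
  have R: "R_mat S \<phi> = (?h - ?\<tau>) *\<^sub>R Rc S + Igg"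
    unfolding R_mat_def Igg_def gamma_eq_beta using \<tau>
    by (subst integral_from_delay) (auto intro!: cont simp: zero)
  have Q22: "b \<bullet> (Q22 S ?\<tau> *v b) = ?\<tau> * (b \<bullet> (Rc S *v b)) + b \<bullet> (Ibb *v b) + b \<bullet> (Igg *v b) - 2 * (b \<bullet> (Ibg *v b))"
  proof -
    let ?F = "\<lambda>\<theta>. transpose (?\<beta> \<theta>) ** Qc S ** ?\<gamma> \<theta> + transpose (?\<gamma> \<theta>) ** Qc S ** ?\<beta> \<theta>"
    have "((\<lambda>\<theta>. b \<bullet> (?F \<theta> *v b)) has_integral b \<bullet> (?I ?F *v b)) {0..?h}"
      unfolding gamma_eq_beta by (intro has_integral_bilinear_form cont)
    moreover have "((\<lambda>\<theta>. b \<bullet> (?F \<theta> *v b)) has_integral (2 * (b \<bullet> (Ibg *v b)))) {0..?h}"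
      by (rule has_integral_eq[OF _ has_integral_mult_right[OF form(5)[of b b], of 2]])
         (simp add: matrix_vector_mult_add_rdistrib inner_add_right congruence_form Qc_commute)
    ultimately have "b \<bullet> (?I ?F *v b) = 2 * (b \<bullet> (Ibg *v b))"
      by (rule has_integral_unique)
    moreover have "integral {?\<tau>..?h} ?F = ?I ?F"
      unfolding gamma_eq_beta using \<tau> by (intro integral_from_delay) (auto intro!: cont simp: zero)
    moreover have "integral {?\<tau>..?h} (\<lambda>\<theta>. transpose (?\<gamma> \<theta>) ** Qc S ** ?\<gamma> \<theta>) = Igg"
      unfolding Igg_def gamma_eq_beta using \<tau> by (intro integral_from_delay) (auto intro!: cont simp: zero)
    ultimately show ?thesis
      unfolding Q22_def Ibb_def[symmetric]
      by (simp add: matrix_vector_mult_add_rdistrib matrix_vector_mult_diff_rdistrib inner_add_right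
          inner_diff_right scaleR_matrix_vector_assoc[symmetric])
  qed
  have Q: "\<zeta> \<bullet> (Q_mat S \<phi> *v \<zeta>) = a \<bullet> (Iaa *v a) + 2 * (a \<bullet> ((Iab - Iag) *v b)) + b \<bullet> (Q22 S ?\<tau> *v b)"
    unfolding \<zeta>_def Q_mat_def block_mat_mult_join inner_join_vec Q12 Q11_def Iaa_def[symmetric]
    using inner_matrix_transpose[of "Iab - Iag" b a]
    by (simp add: inner_add_right inner_commute)
  have W: "\<zeta> \<bullet> (W_mat S \<phi> *v c) = a \<bullet> (Iag *v c) + b \<bullet> (Ibg *v c) - b \<bullet> (Igg *v c)"
  proof -
    let ?F = "\<lambda>\<theta>. stack_mat (transpose (?\<alpha> \<theta>) ** Qc S ** ?\<gamma> \<theta>)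
        (transpose (?\<beta> \<theta>) ** Qc S ** ?\<gamma> \<theta> - transpose (?\<gamma> \<theta>) ** Qc S ** ?\<gamma> \<theta>)"
    have "((\<lambda>\<theta>. \<zeta> \<bullet> (?F \<theta> *v c)) has_integral \<zeta> \<bullet> (?I ?F *v c)) {0..?h}"
      unfolding gamma_eq_beta by (intro has_integral_bilinear_form cont)
    moreover have "((\<lambda>\<theta>. \<zeta> \<bullet> (?F \<theta> *v c)) has_integral (a \<bullet> (Iag *v c) + b \<bullet> (Ibg *v c) - b \<bullet> (Igg *v c))) {0..?h}"
      by (rule has_integral_eq[OF _ has_integral_diff[OF has_integral_add[OF form(4) form(5)] form(6)]])
         (simp add: \<zeta>_def stack_mat_mult_vec inner_join_vec matrix_vector_mult_diff_rdistrib
            inner_diff_right congruence_form)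
    ultimately have "\<zeta> \<bullet> (?I ?F *v c) = a \<bullet> (Iag *v c) + b \<bullet> (Ibg *v c) - b \<bullet> (Igg *v c)"
      by (rule has_integral_unique)
    moreover have "W_mat S \<phi> = ?I ?F"
      unfolding W_mat_def gamma_eq_beta using \<tau>
      by (intro integral_from_delay) (auto intro!: cont simp: zero stack_mat_zero)
    ultimately show ?thesis by simp
  qed
  have x: "x \<theta> = ?\<alpha> \<theta> *v a + ?\<beta> \<theta> *v b - ?\<gamma> \<theta> *v d" for \<theta>
    by (simp add: x_def d_def intersample_def algebra_simps)
  have square: "(p + q - r) \<bullet> (Qc S *v (p + q - r)) =
      p \<bullet> (Qc S *v p) + 2 * (p \<bullet> (Qc S *v q)) + q \<bullet> (Qc S *v q)
      - 2 * (p \<bullet> (Qc S *v r)) - 2 * (q \<bullet> (Qc S *v r)) + r \<bullet> (Qc S *v r)" for p q r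
    using Qc_commute[of q p] Qc_commute[of r p] Qc_commute[of r q]
    by (simp add: matrix_vector_right_distrib matrix_vector_mult_diff_distrib inner_add_left
        inner_add_right inner_diff_left inner_diff_right)
  have state: "((\<lambda>\<theta>. x \<theta> \<bullet> (Qc S *v x \<theta>)) has_integral
      a \<bullet> (Iaa *v a) + 2 * (a \<bullet> (Iab *v b)) + b \<bullet> (Ibb *v b)
      - 2 * (a \<bullet> (Iag *v d)) - 2 * (b \<bullet> (Ibg *v d)) + d \<bullet> (Igg *v d)) {0..?h}"
    unfolding x square
    by (intro has_integral_add has_integral_diff has_integral_mult_right form)
  have input: "((\<lambda>\<theta>. w \<theta> \<bullet> (Rc S *v w \<theta>)) has_integral
      ?\<tau> * (b \<bullet> (Rc S *v b)) + (?h - ?\<tau>) * (c \<bullet> (Rc S *v c))) {0..?h}"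
  proof (rule has_integral_combine)
    have "((\<lambda>\<theta>. b \<bullet> (Rc S *v b)) has_integral ?\<tau> * (b \<bullet> (Rc S *v b))) {0..?\<tau>}"
      using has_integral_const_real[of "b \<bullet> (Rc S *v b)" 0 ?\<tau>] \<tau> by simp
    then show "((\<lambda>\<theta>. w \<theta> \<bullet> (Rc S *v w \<theta>)) has_integral ?\<tau> * (b \<bullet> (Rc S *v b))) {0..?\<tau>}"
      by (rule has_integral_spike_finite[of "{?\<tau>}", rotated 2]) (auto simp: w_def)
    have "((\<lambda>\<theta>. c \<bullet> (Rc S *v c)) has_integral (?h - ?\<tau>) * (c \<bullet> (Rc S *v c))) {?\<tau>..?h}"
      using has_integral_const_real[of "c \<bullet> (Rc S *v c)" ?\<tau> ?h] \<tau> by simp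
    then show "((\<lambda>\<theta>. w \<theta> \<bullet> (Rc S *v w \<theta>)) has_integral (?h - ?\<tau>) * (c \<bullet> (Rc S *v c))) {?\<tau>..?h}"
      by (rule has_integral_eq[rotated]) (auto simp: w_def)
  qed (use \<tau> in auto)
  have sym: "c \<bullet> (Igg *v b) = b \<bullet> (Igg *v c)"
    by (rule has_integral_unique[OF form(6)[of c b]], rule has_integral_eq[OF _ form(6)[of b c]])
       (rule Qc_commute)
  show ?thesis
    by (rule has_integral_eq_rhs[OF has_integral_add[OF state input]])
       (simp add: Q Q22 W R d_def sym matrix_vector_mult_add_rdistrib matrix_vector_mult_diff_rdistrib
         matrix_vector_right_distrib matrix_vector_mult_diff_distrib inner_add_left
         inner_add_right inner_diff_left inner_diff_right scaleR_matrix_vector_assoc[symmetric])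
qed

end

section \<open>Sigma-fields generated by random variables\<close>

lemma space_sigma_sample: "space (sigma (space (sample S)) G) = space (sample S)"
  by (rule space_measure_of_conv)

lemma preimages_subset_sets:
  assumes "f \<in> M \<rightarrow>\<^sub>M N" "space M = space (sample S)"
  shows "preimages S f N \<subseteq> sets M"
  using measurable_sets[OF assms(1)] by (auto simp: preimages_def assms(2))

lemma measurable_sigma_preimages:
  assumes "preimages S f N \<subseteq> G" "G \<subseteq> Pow (space (sample S))"
    and "f \<in> space (sample S) \<rightarrow> space N"
  shows "f \<in> sigma (space (sample S)) G \<rightarrow>\<^sub>M N"
proof (rule measurableI)
  fix X assume "X \<in> sets N"
  then have "f -` X \<inter> space (sample S) \<in> G"
    using assms(1) by (auto simp: preimages_def)
  then show "f -` X \<inter> space (sigma (space (sample S)) G) \<in> sets (sigma (space (sample S)) G)"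
    using assms(2) by (simp add: space_sigma_sample)
qed (use assms(3) in \<open>auto simp: space_sigma_sample\<close>)

lemma measurable_of_measurable_sigma:
  assumes "g \<in> sigma (space (sample S)) G \<rightarrow>\<^sub>M N" "G \<subseteq> sets M" "space M = space (sample S)"
  shows "g \<in> M \<rightarrow>\<^sub>M N"
proof (rule measurableI)
  have "sigma_sets (space (sample S)) G \<subseteq> sets M"
    using sets.sigma_sets_subset[OF assms(2)] by (simp add: assms(3))
  moreover have "G \<subseteq> Pow (space (sample S))"
    using assms(2,3) sets.space_closed[of M] by auto
  ultimately have "sets (sigma (space (sample S)) G) \<subseteq> sets M"
    by simp
  then show "g -` X \<inter> space M \<in> sets M" if "X \<in> sets N" for X
    using measurable_sets[OF assms(1) that] by (auto simp: space_sigma_sample assms(3))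
  show "g \<omega> \<in> space N" if "\<omega> \<in> space M" for \<omega>
    using measurable_space[OF assms(1)] that by (simp add: space_sigma_sample assms(3))
qed

lemma borel_measurable_matrix_vector_mult:
  fixes X :: "'z \<Rightarrow> real ^ 'b ^ 'a"
  assumes "X \<in> borel_measurable M" "y \<in> borel_measurable M"
  shows "(\<lambda>\<omega>. X \<omega> *v y \<omega>) \<in> borel_measurable M"
  using assms by (rule borel_measurable_continuous_Pair) (intro continuous_intros)

lemma borel_measurable_join_vec:
  fixes f :: "'z \<Rightarrow> real ^ 'a::finite" and g :: "'z \<Rightarrow> real ^ 'b::finite"
  assumes "f \<in> borel_measurable M" "g \<in> borel_measurable M"
  shows "(\<lambda>\<omega>. join_vec (f \<omega>) (g \<omega>)) \<in> borel_measurable M"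
  using assms by (rule borel_measurable_continuous_Pair) (intro continuous_intros)

lemma borel_measurable_join_vecD:
  fixes f :: "'z \<Rightarrow> real ^ 'a::finite" and g :: "'z \<Rightarrow> real ^ 'b::finite"
  assumes "(\<lambda>\<omega>. join_vec (f \<omega>) (g \<omega>)) \<in> borel_measurable M"
  shows "f \<in> borel_measurable M" "g \<in> borel_measurable M"
proof -
  have "(\<lambda>z :: real ^ ('a + 'b). \<chi> a. z $ Inl a) \<in> borel_measurable borel"
    "(\<lambda>z :: real ^ ('a + 'b). \<chi> b. z $ Inr b) \<in> borel_measurable borel"
    by (intro borel_measurable_continuous_onI continuous_intros)+
  from this[THEN measurable_compose[OF assms]]
  show "f \<in> borel_measurable M" "g \<in> borel_measurable M" by simp_all
qed

section \<open>The change of control variables\<close>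

definition feedback :: "('n::finite, 'm::finite, 'w) sampled_system \<Rightarrow> (nat \<Rightarrow> real) \<Rightarrow> real ^ ('n + 'm) ^ 'm" where
  "feedback S \<phi> = matrix_inv (R_mat S \<phi>) ** transpose (W_mat S \<phi>)"

text \<open>A relation rather than a function of \<open>u\<close>: controls are arbitrary functions outside the sample
  space, where no trajectory need exist, so the correspondence can be required on the sample space only.\<close>

definition shifted_by_feedback ::
  "('n::finite, 'm::finite, 'w) sampled_system \<Rightarrow> ('m, 'w) control \<Rightarrow> ('m, 'w) control \<Rightarrow> bool" where
  "shifted_by_feedback S u v \<longleftrightarrow>
     (\<forall>\<omega>\<in>space (sample S). \<forall>k. v k \<omega> = u k \<omega> + feedback S (phi S k \<omega>) *v xi S u k \<omega>)"

abbreviation jump_xi ::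
  "('n::finite, 'm::finite, 'w) sampled_system \<Rightarrow> ('m, 'w) control \<Rightarrow> nat \<Rightarrow> 'w \<Rightarrow> real ^ ('n + 'm)" where
  "jump_xi S v \<equiv> jump_state S (A_bar S) (B_mat S) v"

abbreviation F_jump :: "('n::finite, 'm::finite, 'w) sampled_system \<Rightarrow> ('m, 'w) control \<Rightarrow> nat \<Rightarrow> 'w measure" where
  "F_jump S v \<equiv> F_d S (A_bar S) (B_mat S) v"

context sampled_LQ
begin

lemma A_bar_eq: "A_bar S \<phi> = A_mat S \<phi> - B_mat S \<phi> ** feedback S \<phi>"
  by (simp add: A_bar_def feedback_def matrix_mul_assoc)

lemma A_bar_closed_loop:
  "A_bar S \<phi> *v \<xi> + B_mat S \<phi> *v v = A_mat S \<phi> *v \<xi> + B_mat S \<phi> *v (v - feedback S \<phi> *v \<xi>)"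
  by (simp add: A_bar_eq matrix_vector_mult_diff_rdistrib matrix_vector_mult_diff_distrib
      matrix_vector_mul_assoc)

lemma jump_xi_eq_xi:
  assumes uv: "shifted_by_feedback S u v" and \<omega>: "\<omega> \<in> space (sample S)"
  shows "jump_xi S v k \<omega> = xi S u k \<omega>"
proof (induction k)
  case (Suc k)
  have "v k \<omega> - feedback S (phi S k \<omega>) *v xi S u k \<omega> = u k \<omega>"
    using uv \<omega> by (simp add: shifted_by_feedback_def)
  then show ?case
    using Suc by (simp add: A_bar_closed_loop xi_Suc[OF \<omega>])
qed (simp add: xi_0[OF \<omega>])

text \<open>The shift of \<open>u\<^sub>k\<close> involves the plant state, which depends on the earlier \<open>u\<close> only. Expressing that
  state through \<open>v\<close> as the state of the jump system resolves the recursion explicitly.\<close>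

lemma jump_control_is_shifted: "\<exists>u. shifted_by_feedback S u v"
proof -
  define u where "u k \<omega> = v k \<omega> - feedback S (phi S k \<omega>) *v jump_xi S v k \<omega>" for k \<omega>
  have "xi S u k \<omega> = jump_xi S v k \<omega>" if \<omega>: "\<omega> \<in> space (sample S)" for k \<omega>
  proof (induction k)
    case (Suc k)
    then show ?case by (simp add: xi_Suc[OF \<omega>] u_def A_bar_closed_loop)
  qed (simp add: xi_0[OF \<omega>])
  then have "shifted_by_feedback S u v"
    by (simp add: shifted_by_feedback_def u_def)
  then show ?thesis by blast
qed

section \<open>Measurability and information structure\<close>

lemma continuous_on_inv_R: "continuous_on {0..<period S} (\<lambda>\<tau>. matrix_inv (R_mat S (\<lambda>_. \<tau>)))"
  by (intro continuous_on_matrix_inv continuous_on_R_mat pos_def_invertible R_mat_pos_def) simp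

lemma continuous_on_feedback: "continuous_on {0..<period S} (\<lambda>\<tau>. feedback S (\<lambda>_. \<tau>))"
  unfolding feedback_def by (intro continuous_intros continuous_on_inv_R continuous_on_W_mat)

lemma continuous_on_A_bar: "continuous_on {0..<period S} (\<lambda>\<tau>. A_bar S (\<lambda>_. \<tau>))"
  unfolding A_bar_eq
  by (intro continuous_intros continuous_on_A_mat continuous_on_B_mat continuous_on_feedback)

text \<open>The coefficients depend on the delay history through its first entry only, so continuity in one real
  variable yields measurability on the product space.\<close>

lemma first_entry:
  fixes \<phi> :: "nat \<Rightarrow> real"
  shows "B_mat S \<phi> = B_mat S (\<lambda>_. \<phi> 0)" "A_bar S \<phi> = A_bar S (\<lambda>_. \<phi> 0)"
  "feedback S \<phi> = feedback S (\<lambda>_. \<phi> 0)" "R_mat S \<phi> = R_mat S (\<lambda>_. \<phi> 0)"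
  "W_mat S \<phi> = W_mat S (\<lambda>_. \<phi> 0)" "Q_mat S \<phi> = Q_mat S (\<lambda>_. \<phi> 0)"
  by (simp_all add: A_mat_def B_mat_def A_bar_def feedback_def R_mat_def W_mat_def Q_mat_def)

lemma borel_measurable_first_entry:
  fixes F :: "real \<Rightarrow> 'b::topological_space"
  assumes F: "continuous_on {0..<period S} F" and f: "f \<in> M \<rightarrow>\<^sub>M delay_space S"
  shows "(\<lambda>\<omega>. F (f \<omega> 0)) \<in> borel_measurable M"
proof -
  have "(\<lambda>\<phi>. \<phi> 0) \<in> delay_space S \<rightarrow>\<^sub>M restrict_space borel {tau_min S..tau_max S}"
    unfolding delay_space_def using lags_pos by (intro measurable_component_singleton) simp
  moreover have "F \<in> borel_measurable (restrict_space borel {tau_min S..tau_max S})"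
    using tau_min_nonneg tau_max_less
    by (intro borel_measurable_continuous_on_restrict continuous_on_subset[OF F]) auto
  ultimately have "(\<lambda>\<phi>. F (\<phi> 0)) \<in> borel_measurable (delay_space S)"
    by (rule measurable_compose)
  from measurable_compose[OF f this] show ?thesis .
qed

lemma borel_measurable_A_bar: "f \<in> M \<rightarrow>\<^sub>M delay_space S \<Longrightarrow> (\<lambda>\<omega>. A_bar S (f \<omega>)) \<in> borel_measurable M"
  by (subst first_entry(2)) (rule borel_measurable_first_entry[OF continuous_on_A_bar])

lemma borel_measurable_B_mat: "f \<in> M \<rightarrow>\<^sub>M delay_space S \<Longrightarrow> (\<lambda>\<omega>. B_mat S (f \<omega>)) \<in> borel_measurable M"
  by (subst first_entry(1)) (rule borel_measurable_first_entry[OF continuous_on_B_mat])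

lemma borel_measurable_feedback: "f \<in> M \<rightarrow>\<^sub>M delay_space S \<Longrightarrow> (\<lambda>\<omega>. feedback S (f \<omega>)) \<in> borel_measurable M"
  by (subst first_entry(3)) (rule borel_measurable_first_entry[OF continuous_on_feedback])

lemma borel_measurable_R_mat: "f \<in> M \<rightarrow>\<^sub>M delay_space S \<Longrightarrow> (\<lambda>\<omega>. R_mat S (f \<omega>)) \<in> borel_measurable M"
  by (subst first_entry(4)) (rule borel_measurable_first_entry[OF continuous_on_R_mat])

text \<open>The weight is \<open>C\<^sup>T C\<close>. Factors \<open>C\<close>, \<open>D\<close> chosen pointwise need not depend measurably on \<open>\<phi>\<close>, so
  the measurability of the stage costs has to come from the products \<open>C\<^sup>T C\<close> and \<open>D\<^sup>T D\<close>.\<close>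

lemma borel_measurable_state_weight:
  assumes "f \<in> M \<rightarrow>\<^sub>M delay_space S"
  shows "(\<lambda>\<omega>. Q_mat S (f \<omega>) - W_mat S (f \<omega>) ** matrix_inv (R_mat S (f \<omega>)) ** transpose (W_mat S (f \<omega>)))
    \<in> borel_measurable M"
  by (subst first_entry(6), subst (1 2) first_entry(5), subst first_entry(4))
     (intro borel_measurable_first_entry[OF _ assms] continuous_intros continuous_on_Q_mat
        continuous_on_W_mat continuous_on_inv_R)

lemma init_measurable: "x_init S \<in> borel_measurable (sample S)" "u_init S \<in> borel_measurable (sample S)"
  using delays by (simp_all add: markov_delays_def)

lemma F_c_generators:
  "preimages S (u_init S) borel \<union>
      (\<Union>j\<le>k. preimages S (plant_state S u (real j * period S)) borel \<union> preimages S (phi S j) (delay_space S))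
   \<subseteq> Pow (space (sample S))"
  by (auto simp: preimages_def)

lemma space_F_c: "space (F_c S u k) = space (sample S)"
  unfolding F_c_def by (rule space_sigma_sample)

lemma space_F_d: "space (F_d S F G v k) = space (sample S)"
  unfolding F_d_def by (rule space_sigma_sample)

lemma phi_space: "phi S j \<in> space (sample S) \<rightarrow> space (delay_space S)"
  using measurable_space[OF measurable_phi] by auto

lemma F_c_measurable:
  shows "u_init S \<in> borel_measurable (F_c S u k)"
    and "j \<le> k \<Longrightarrow> plant_state S u (real j * period S) \<in> borel_measurable (F_c S u k)"
    and "j \<le> k \<Longrightarrow> phi S j \<in> F_c S u k \<rightarrow>\<^sub>M delay_space S"
  unfolding F_c_def
  by (rule measurable_sigma_preimages; (rule F_c_generators | use phi_space in auto))+

lemma F_c_least: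
  assumes "g \<in> F_c S u k \<rightarrow>\<^sub>M N" and M: "space M = space (sample S)"
    and "u_init S \<in> borel_measurable M"
    and "\<And>j. j \<le> k \<Longrightarrow> plant_state S u (real j * period S) \<in> borel_measurable M"
    and "\<And>j. j \<le> k \<Longrightarrow> phi S j \<in> M \<rightarrow>\<^sub>M delay_space S"
  shows "g \<in> M \<rightarrow>\<^sub>M N"
  using assms(1) unfolding F_c_def
  by (rule measurable_of_measurable_sigma)
     (intro Un_least UN_least preimages_subset_sets M assms, auto simp: M)

lemma F_d_measurable:
  assumes "j \<le> k"
  shows "jump_state S F G v j \<in> borel_measurable (F_d S F G v k)"
    and "phi S j \<in> F_d S F G v k \<rightarrow>\<^sub>M delay_space S"
proof -
  have *: "(\<Union>j\<le>k. preimages S (jump_state S F G v j) borel \<union> preimages S (phi S j) (delay_space S))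
      \<subseteq> Pow (space (sample S))"
    by (auto simp: preimages_def)
  show "jump_state S F G v j \<in> borel_measurable (F_d S F G v k)"
    "phi S j \<in> F_d S F G v k \<rightarrow>\<^sub>M delay_space S"
    unfolding F_d_def
    by (rule measurable_sigma_preimages[OF _ *]; use phi_space assms in auto)+
qed

lemma F_d_least:
  assumes "g \<in> F_d S F G v k \<rightarrow>\<^sub>M N" and M: "space M = space (sample S)"
    and "\<And>j. j \<le> k \<Longrightarrow> jump_state S F G v j \<in> borel_measurable M"
    and "\<And>j. j \<le> k \<Longrightarrow> phi S j \<in> M \<rightarrow>\<^sub>M delay_space S"
  shows "g \<in> M \<rightarrow>\<^sub>M N"
  using assms(1) unfolding F_d_def
  by (rule measurable_of_measurable_sigma)
     (intro Un_least UN_least preimages_subset_sets M assms, auto simp: M)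

lemma borel_measurable_cong_sample:
  assumes "space M = space (sample S)" "\<And>\<omega>. \<omega> \<in> space (sample S) \<Longrightarrow> f \<omega> = g \<omega>"
  shows "f \<in> M \<rightarrow>\<^sub>M N \<longleftrightarrow> g \<in> M \<rightarrow>\<^sub>M N"
  using assms by (intro measurable_cong) auto

lemma jump_xi_eq_join:
  assumes "shifted_by_feedback S u v" "\<omega> \<in> space (sample S)"
  shows "jump_xi S v k \<omega> = join_vec (plant_state S u (real k * period S) \<omega>) (prev_input S u k \<omega>)"
  using jump_xi_eq_xi[OF assms] by (simp add: xi_eq)

lemma jump_xi_measurable_iff:
  assumes uv: "shifted_by_feedback S u v" and M: "space M = space (sample S)"
  shows "jump_xi S v k \<in> borel_measurable M \<longleftrightarrow>
    plant_state S u (real k * period S) \<in> borel_measurable M \<and> prev_input S u k \<in> borel_measurable M"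
proof -
  let ?x = "plant_state S u (real k * period S)" and ?w = "prev_input S u k"
  have "jump_xi S v k \<in> borel_measurable M \<longleftrightarrow> (\<lambda>\<omega>. join_vec (?x \<omega>) (?w \<omega>)) \<in> borel_measurable M"
    by (rule borel_measurable_cong_sample[OF M jump_xi_eq_join[OF uv]])
  also have "\<dots> \<longleftrightarrow> ?x \<in> borel_measurable M \<and> ?w \<in> borel_measurable M"
    by (intro iffI conjI; (elim conjE)?; (rule borel_measurable_join_vecD borel_measurable_join_vec; assumption))
  finally show ?thesis .
qed

lemma shifted_control_measurable_iff:
  assumes uv: "shifted_by_feedback S u v" and M: "space M = space (sample S)"
    and "jump_xi S v k \<in> borel_measurable M" "phi S k \<in> M \<rightarrow>\<^sub>M delay_space S"
  shows "u k \<in> borel_measurable M \<longleftrightarrow> v k \<in> borel_measurable M"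
proof -
  let ?f = "\<lambda>\<omega>. feedback S (phi S k \<omega>) *v jump_xi S v k \<omega>"
  have f: "?f \<in> borel_measurable M"
    by (intro borel_measurable_matrix_vector_mult borel_measurable_feedback assms)
  have eq: "v k \<omega> = u k \<omega> + ?f \<omega>" if "\<omega> \<in> space (sample S)" for \<omega>
    using uv that jump_xi_eq_xi[OF uv that] by (simp add: shifted_by_feedback_def)
  show ?thesis
  proof
    assume "u k \<in> borel_measurable M"
    then have "(\<lambda>\<omega>. u k \<omega> + ?f \<omega>) \<in> borel_measurable M" using f by simp
    then show "v k \<in> borel_measurable M"
      using borel_measurable_cong_sample[OF M, of "v k" "\<lambda>\<omega>. u k \<omega> + ?f \<omega>"] eq by blast
  next
    assume "v k \<in> borel_measurable M"
    then have "(\<lambda>\<omega>. v k \<omega> - ?f \<omega>) \<in> borel_measurable M" using f by simp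
    moreover have "u k \<omega> = v k \<omega> - ?f \<omega>" if "\<omega> \<in> space (sample S)" for \<omega>
      using eq[OF that] by simp
    ultimately show "u k \<in> borel_measurable M"
      using borel_measurable_cong_sample[OF M, of "u k" "\<lambda>\<omega>. v k \<omega> - ?f \<omega>"] by blast
  qed
qed

text \<open>From \<open>u\<close> to \<open>v\<close>: the jump state contains \<open>x(jh)\<close> and, at \<open>j = 0\<close>, also \<open>u\<^sub>-\<^sub>1\<close>, so the
  sigma-field of the jump system is at least as fine as that of the plant. From \<open>v\<close> to \<open>u\<close>: the jump states
  up to \<open>k\<close> contain the inputs \<open>u\<^sub>j\<close> with \<open>j < k\<close>, which by strong induction are observed in the plant; hence
  \<open>v\<^sub>k\<close> and then \<open>u\<^sub>k\<close> are.\<close>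

lemma adapted_iff:
  assumes uv: "shifted_by_feedback S u v"
  shows "(\<forall>k. u k \<in> borel_measurable (F_c S u k)) \<longleftrightarrow> (\<forall>k. v k \<in> borel_measurable (F_jump S v k))"
proof
  assume u: "\<forall>k. u k \<in> borel_measurable (F_c S u k)"
  show "\<forall>k. v k \<in> borel_measurable (F_jump S v k)"
  proof
    fix k
    let ?M = "F_jump S v k"
    note jump = F_d_measurable[of _ k "A_bar S" "B_mat S" v]
    note iff = jump_xi_measurable_iff[OF uv space_F_d[of "A_bar S" "B_mat S" v k]]
    have "prev_input S u 0 \<in> borel_measurable ?M"
      using jump(1)[of 0] iff by blast
    then have "u_init S \<in> borel_measurable ?M"
      by (simp add: prev_input_simps(1)[abs_def])
    moreover have "plant_state S u (real j * period S) \<in> borel_measurable ?M" if "j \<le> k" for j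
      using iff jump(1)[OF that] by blast
    ultimately have "u k \<in> borel_measurable ?M"
      by (rule F_c_least[OF u[rule_format] space_F_d _ _ jump(2)])
    then show "v k \<in> borel_measurable ?M"
      using shifted_control_measurable_iff[OF uv space_F_d jump[OF order_refl]] by blast
  qed
next
  assume v: "\<forall>k. v k \<in> borel_measurable (F_jump S v k)"
  have "u k \<in> borel_measurable (F_c S u k)" for k
  proof (induction k rule: less_induct)
    case (less k)
    let ?M = "F_c S u k"
    have jump: "jump_xi S v j \<in> borel_measurable ?M" if "j \<le> k" for j
    proof -
      have "prev_input S u j \<in> borel_measurable ?M"
      proof (cases j)
        case 0
        then show ?thesis using F_c_measurable(1) by (simp add: prev_input_simps(1)[abs_def])
      next
        case (Suc i)
        then have "u i \<in> borel_measurable ?M"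
          using that less[of i] by (rule_tac F_c_least[OF _ space_F_c]) (auto intro: F_c_measurable)
        then show ?thesis using Suc by (simp add: prev_input_simps(2)[abs_def])
      qed
      then show ?thesis
        using F_c_measurable(2)[OF that] jump_xi_measurable_iff[OF uv space_F_c] by blast
    qed
    have "v k \<in> borel_measurable ?M"
      by (rule F_d_least[OF v[rule_format] space_F_c jump F_c_measurable(3)])
    then show ?case
      using shifted_control_measurable_iff[OF uv space_F_c jump F_c_measurable(3)] by blast
  qed
  then show "\<forall>k. u k \<in> borel_measurable (F_c S u k)" ..
qed

lemma adapted_sample_measurable:
  assumes v: "\<forall>k. v k \<in> borel_measurable (F_jump S v k)"
  shows "jump_xi S v k \<in> borel_measurable (sample S)" "v k \<in> borel_measurable (sample S)"
proof -
  have "\<forall>j\<le>k. jump_xi S v j \<in> borel_measurable (sample S)" for k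
  proof (induction k)
    case 0
    show ?case
      by (auto simp: xi_init_def[abs_def] intro!: borel_measurable_join_vec init_measurable)
  next
    case (Suc k)
    have "v k \<in> borel_measurable (sample S)"
      using Suc by (rule_tac F_d_least[OF v[rule_format] refl _ measurable_phi]) auto
    then have "jump_xi S v (Suc k) \<in> borel_measurable (sample S)"
      using Suc by (auto intro!: borel_measurable_add borel_measurable_matrix_vector_mult
          borel_measurable_A_bar borel_measurable_B_mat measurable_phi)
    then show ?case using Suc by (auto simp: le_Suc_eq)
  qed
  then have jump: "jump_xi S v k \<in> borel_measurable (sample S)" for k by blast
  then show "jump_xi S v k \<in> borel_measurable (sample S)" .
  show "v k \<in> borel_measurable (sample S)"
    by (rule F_d_least[OF v[rule_format] refl jump measurable_phi])
qed

lemma prob_of_sample: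
  assumes "admissible S \<nu>"
  shows "sets (prob_of S \<nu>) = sets (sample S)" "space (prob_of S \<nu>) = space (sample S)"
proof -
  show "sets (prob_of S \<nu>) = sets (sample S)"
    using delays assms by (simp add: markov_delays_def)
  then show "space (prob_of S \<nu>) = space (sample S)"
    by (rule sets_eq_imp_space_eq)
qed

end

context sampled_LQ
begin

section \<open>Stability\<close>

lemma borel_measurable_norm_power2:
  fixes f :: "'z \<Rightarrow> real ^ 'a"
  assumes "f \<in> borel_measurable M"
  shows "(\<lambda>\<omega>. ennreal ((norm (f \<omega>))\<^sup>2)) \<in> borel_measurable M"
  using assms by measurable

lemma response_bounds:
  obtains M where "M \<ge> 0" "\<And>\<theta> a. \<theta> \<in> {0..period S} \<Longrightarrow> norm (alpha S \<theta> *v a) \<le> M * norm a"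
    "\<And>r b. r \<le> period S \<Longrightarrow> norm (beta S r *v b) \<le> M * norm b"
proof -
  obtain Ka where Ka: "\<And>X :: real ^ 'n ^ 'n. \<And>a. norm (X *v a) \<le> norm X * norm a * Ka" "Ka > 0"
    using bounded_bilinear.pos_bounded[OF bounded_bilinear_matrix_vector_mult] by blast
  obtain Kb where Kb: "\<And>X :: real ^ 'm ^ 'n. \<And>a. norm (X *v a) \<le> norm X * norm a * Kb" "Kb > 0"
    using bounded_bilinear.pos_bounded[OF bounded_bilinear_matrix_vector_mult] by blast
  have "bounded (alpha S ` {0..period S})" "bounded (beta S ` {0..period S})"
    by (intro compact_imp_bounded compact_continuous_image continuous_on_alpha continuous_on_beta
        continuous_on_id compact_Icc)+
  then obtain Ma Mb where Ma: "\<And>\<theta>. \<theta> \<in> {0..period S} \<Longrightarrow> norm (alpha S \<theta>) \<le> Ma"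
    and Mb: "\<And>\<theta>. \<theta> \<in> {0..period S} \<Longrightarrow> norm (beta S \<theta>) \<le> Mb"
    unfolding bounded_iff by blast
  have nonneg: "0 \<le> Ma" "0 \<le> Mb"
    using order_trans[OF norm_ge_zero Ma[of 0]] order_trans[OF norm_ge_zero Mb[of 0]] period_pos by auto
  have Mb': "norm (beta S r) \<le> Mb" if "r \<le> period S" for r
    using Mb[of r] that nonneg by (cases "r \<le> 0") auto
  show ?thesis
  proof (rule that[of "Ma * Ka + Mb * Kb"])
    show "0 \<le> Ma * Ka + Mb * Kb"
      using nonneg Ka Kb by simp
    fix \<theta> and a :: "real ^ 'n" assume \<theta>: "\<theta> \<in> {0..period S}"
    have "norm (alpha S \<theta> *v a) \<le> norm (alpha S \<theta>) * norm a * Ka" by (rule Ka)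
    also have "\<dots> \<le> Ma * norm a * Ka"
      using Ma[OF \<theta>] Ka by (intro mult_right_mono) auto
    also have "\<dots> \<le> (Ma * Ka + Mb * Kb) * norm a"
      using nonneg Kb by (simp add: algebra_simps)
    finally show "norm (alpha S \<theta> *v a) \<le> (Ma * Ka + Mb * Kb) * norm a" .
  next
    fix r and b :: "real ^ 'm" assume r: "r \<le> period S"
    have "norm (beta S r *v b) \<le> norm (beta S r) * norm b * Kb" by (rule Kb)
    also have "\<dots> \<le> Mb * norm b * Kb"
      using Mb'[OF r] Kb by (intro mult_right_mono) auto
    also have "\<dots> \<le> (Ma * Ka + Mb * Kb) * norm b"
      using nonneg Ka by (simp add: algebra_simps)
    finally show "norm (beta S r *v b) \<le> (Ma * Ka + Mb * Kb) * norm b" .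
  qed
qed

text \<open>The responses \<open>\<alpha>\<close> and \<open>\<beta>\<close> are bounded on a period. The state \<open>\<xi>\<^sub>k\<^sub>+\<^sub>1\<close> enters the bound because it
  contains the input \<open>u\<^sub>k\<close>; the factor \<open>6 = 1 + 4 + 1\<close> comes from the Cauchy-Schwarz inequality for
  \<open>p + 2q + r\<close>.\<close>

lemma intersample_bound:
  "\<exists>c\<ge>0. \<forall>\<omega>\<in>space (sample S). \<forall>k. \<forall>\<theta>\<in>{0..period S}.
      (norm (plant_state S u (real k * period S + \<theta>) \<omega>))\<^sup>2
        \<le> c * ((norm (xi S u k \<omega>))\<^sup>2 + (norm (xi S u (Suc k) \<omega>))\<^sup>2)"
proof -
  obtain M where M: "M \<ge> 0" "\<And>\<theta> a. \<theta> \<in> {0..period S} \<Longrightarrow> norm (alpha S \<theta> *v a) \<le> M * norm a"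
    "\<And>r b. r \<le> period S \<Longrightarrow> norm (beta S r *v b) \<le> M * norm b"
    using response_bounds by blast
  show ?thesis
  proof (intro exI[of _ "6 * M\<^sup>2"] conjI ballI allI)
    fix \<omega> k \<theta> assume \<omega>: "\<omega> \<in> space (sample S)" and \<theta>: "\<theta> \<in> {0..period S}"
    let ?a = "plant_state S u (real k * period S) \<omega>" and ?b = "prev_input S u k \<omega>" and ?\<tau> = "delay S (int k) \<omega>"
    have r: "\<theta> \<le> period S" "\<theta> - ?\<tau> \<le> period S"
      using \<theta> delay_bounds[OF \<omega>, of k] by auto
    let ?x = "plant_state S u (real k * period S + \<theta>) \<omega>"
    have x: "?x = alpha S \<theta> *v ?a + beta S \<theta> *v ?b - beta S (\<theta> - ?\<tau>) *v ?b + beta S (\<theta> - ?\<tau>) *v u k \<omega>"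
      unfolding plant_state_within_period[OF \<omega> \<theta>] intersample_def gamma_eq_beta
      by (simp add: matrix_vector_mult_diff_rdistrib)
    have "norm ?x \<le> norm (alpha S \<theta> *v ?a) + norm (beta S \<theta> *v ?b) + norm (beta S (\<theta> - ?\<tau>) *v ?b)
        + norm (beta S (\<theta> - ?\<tau>) *v u k \<omega>)"
      unfolding x by (intro order_trans[OF norm_triangle_ineq] add_mono order_trans[OF norm_triangle_ineq4]) auto
    also have "\<dots> \<le> M * norm ?a + M * norm ?b + M * norm ?b + M * norm (u k \<omega>)"
      by (intro add_mono M \<theta> r)
    also have "\<dots> = M * (norm ?a + 2 * norm ?b + norm (u k \<omega>))"
      by (simp add: algebra_simps)
    finally have "(norm ?x)\<^sup>2 \<le> (M * (norm ?a + 2 * norm ?b + norm (u k \<omega>)))\<^sup>2"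
      by (rule power_mono) simp
    also have "\<dots> = M\<^sup>2 * (norm ?a + 2 * norm ?b + norm (u k \<omega>))\<^sup>2"
      by (simp add: power_mult_distrib)
    also have "\<dots> \<le> M\<^sup>2 * (6 * ((norm ?a)\<^sup>2 + (norm ?b)\<^sup>2 + (norm (u k \<omega>))\<^sup>2))"
    proof (rule mult_left_mono)
      have sq: "(p + 2 * q + r)\<^sup>2 \<le> 6 * (p\<^sup>2 + q\<^sup>2 + r\<^sup>2)" for p q r :: real
      proof -
        have "6 * (p\<^sup>2 + q\<^sup>2 + r\<^sup>2) - (p + 2 * q + r)\<^sup>2 = (2 * p - q)\<^sup>2 + (p - r)\<^sup>2 + (2 * r - q)\<^sup>2"
          by (simp add: power2_eq_square algebra_simps)
        also have "\<dots> \<ge> 0" by simp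
        finally show ?thesis by simp
      qed
      show "(norm ?a + 2 * norm ?b + norm (u k \<omega>))\<^sup>2 \<le> 6 * ((norm ?a)\<^sup>2 + (norm ?b)\<^sup>2 + (norm (u k \<omega>))\<^sup>2)"
        by (rule sq)
    qed simp
    also have "\<dots> \<le> 6 * M\<^sup>2 * ((norm (xi S u k \<omega>))\<^sup>2 + (norm (xi S u (Suc k) \<omega>))\<^sup>2)"
    proof -
      have "(norm ?a)\<^sup>2 + (norm ?b)\<^sup>2 + (norm (u k \<omega>))\<^sup>2 \<le> (norm (xi S u k \<omega>))\<^sup>2 + (norm (xi S u (Suc k) \<omega>))\<^sup>2"
        by (simp add: xi_eq norm_join_vec_power2)
      from mult_left_mono[OF this, of "6 * M\<^sup>2"] show ?thesis
        by (simp only: mult.assoc mult.left_commute[of "M\<^sup>2"] zero_le_power2) (simp add: zero_le_mult_iff)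
    qed
    finally show "(norm ?x)\<^sup>2 \<le> 6 * M\<^sup>2 * ((norm (xi S u k \<omega>))\<^sup>2 + (norm (xi S u (Suc k) \<omega>))\<^sup>2)" .
  qed simp
qed

text \<open>Convergence along all real times amounts to convergence along the sampling times, since the
  mean square of the state in between is dominated by those of the two adjacent \<open>\<xi>\<close>. The inputs are
  components of \<open>\<xi>\<close>, shifted by one step.\<close>

lemma stable_iff:
  assumes uv: "shifted_by_feedback S u v" and v: "\<forall>k. v k \<in> borel_measurable (F_jump S v k)"
    and \<nu>: "admissible S \<nu>"
  shows "((\<lambda>t. \<integral>\<^sup>+\<omega>. ennreal ((norm (plant_state S u t \<omega>))\<^sup>2) \<partial>prob_of S \<nu>) \<longlongrightarrow> 0) at_top \<and>
        (\<lambda>k. \<integral>\<^sup>+\<omega>. ennreal ((norm (u k \<omega>))\<^sup>2) \<partial>prob_of S \<nu>) \<longlonglongrightarrow> 0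
     \<longleftrightarrow> (\<lambda>k. \<integral>\<^sup>+\<omega>. ennreal ((norm (jump_xi S v k \<omega>))\<^sup>2) \<partial>prob_of S \<nu>) \<longlonglongrightarrow> 0"
    (is "(?X \<longlongrightarrow> 0) at_top \<and> ?U \<longlonglongrightarrow> 0 \<longleftrightarrow> ?J \<longlonglongrightarrow> 0")
proof -
  note space = prob_of_sample(2)[OF \<nu>]
  note meas = measurable_cong_sets[OF prob_of_sample(1)[OF \<nu>] refl]
  have jump: "jump_xi S v k \<omega> = xi S u k \<omega>" if "\<omega> \<in> space (prob_of S \<nu>)" for k \<omega>
    using jump_xi_eq_xi[OF uv] that space by auto
  have jump_meas: "jump_xi S v k \<in> borel_measurable (prob_of S \<nu>)" for k
    unfolding meas by (rule adapted_sample_measurable(1)[OF v])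
  have split: "?J k = ?X (real k * period S) + (\<integral>\<^sup>+\<omega>. ennreal ((norm (prev_input S u k \<omega>))\<^sup>2) \<partial>prob_of S \<nu>)" for k
  proof -
    have m: "plant_state S u (real k * period S) \<in> borel_measurable (prob_of S \<nu>)"
      "prev_input S u k \<in> borel_measurable (prob_of S \<nu>)"
      using jump_xi_measurable_iff[OF uv space] jump_meas by blast+
    have "?J k = (\<integral>\<^sup>+\<omega>. ennreal ((norm (plant_state S u (real k * period S) \<omega>))\<^sup>2)
        + ennreal ((norm (prev_input S u k \<omega>))\<^sup>2) \<partial>prob_of S \<nu>)"
      by (intro nn_integral_cong) (simp add: jump xi_eq norm_join_vec_power2)
    also have "\<dots> = ?X (real k * period S) + (\<integral>\<^sup>+\<omega>. ennreal ((norm (prev_input S u k \<omega>))\<^sup>2) \<partial>prob_of S \<nu>)"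
      by (intro nn_integral_add borel_measurable_norm_power2 m)
    finally show ?thesis .
  qed
  have split_Suc: "?J (Suc k) = ?X (real (Suc k) * period S) + ?U k" for k
    unfolding split by simp
  show ?thesis
  proof (intro iffI; (elim conjE)?)
    assume X: "(?X \<longlongrightarrow> 0) at_top" and U: "?U \<longlonglongrightarrow> 0"
    have "filterlim (\<lambda>k. real (Suc k) * period S) at_top sequentially"
      using filterlim_tendsto_pos_mult_at_top[OF tendsto_const period_pos
          filterlim_compose[OF filterlim_real_sequentially filterlim_Suc]]
      by (simp add: mult.commute)
    from tendsto_add[OF filterlim_compose[OF X this] U]
    have "(\<lambda>k. ?J (Suc k)) \<longlonglongrightarrow> 0"
      unfolding split_Suc by simp
    then show "?J \<longlonglongrightarrow> 0" by (rule LIMSEQ_imp_Suc)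
  next
    assume J: "?J \<longlonglongrightarrow> 0"
    then have J': "(\<lambda>k. ?J (Suc k)) \<longlonglongrightarrow> 0" by (rule LIMSEQ_Suc)
    have U: "?U \<longlonglongrightarrow> 0"
      by (rule tendsto_sandwich[OF _ _ tendsto_const J']) (auto simp: split_Suc simp del: jump_state.simps)
    obtain c where c: "c \<ge> 0" "\<And>\<omega> k \<theta>. \<omega> \<in> space (sample S) \<Longrightarrow> \<theta> \<in> {0..period S} \<Longrightarrow>
      (norm (plant_state S u (real k * period S + \<theta>) \<omega>))\<^sup>2
        \<le> c * ((norm (xi S u k \<omega>))\<^sup>2 + (norm (xi S u (Suc k) \<omega>))\<^sup>2)"
      using intersample_bound[of u] by metis
    have bound: "?X t \<le> ennreal c * (?J (nat \<lfloor>t / period S\<rfloor>) + ?J (Suc (nat \<lfloor>t / period S\<rfloor>)))"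
      if "t \<ge> 0" for t
    proof -
      define k where "k = nat \<lfloor>t / period S\<rfloor>"
      define \<theta> where "\<theta> = t - real k * period S"
      have "real k = of_int \<lfloor>t / period S\<rfloor>"
        using that period_pos by (simp add: k_def)
      then have "real k \<le> t / period S" "t / period S \<le> real k + 1" by linarith+
      then have "\<theta> \<in> {0..period S}"
        using period_pos by (auto simp: \<theta>_def field_simps)
      moreover have t: "t = real k * period S + \<theta>" by (simp add: \<theta>_def)
      ultimately have "?X t \<le> (\<integral>\<^sup>+\<omega>. ennreal c * (ennreal ((norm (jump_xi S v k \<omega>))\<^sup>2)
          + ennreal ((norm (jump_xi S v (Suc k) \<omega>))\<^sup>2)) \<partial>prob_of S \<nu>)"
        using c space
        by (intro nn_integral_mono)
           (simp add: jump ennreal_plus[symmetric] ennreal_mult[symmetric] ennreal_leI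
             del: jump_state.simps ennreal_plus)
      also have "\<dots> = ennreal c * (\<integral>\<^sup>+\<omega>. ennreal ((norm (jump_xi S v k \<omega>))\<^sup>2)
          + ennreal ((norm (jump_xi S v (Suc k) \<omega>))\<^sup>2) \<partial>prob_of S \<nu>)"
        by (intro nn_integral_cmult borel_measurable_add borel_measurable_norm_power2 jump_meas)
      also have "\<dots> = ennreal c * (?J k + ?J (Suc k))"
        by (simp only: nn_integral_add borel_measurable_norm_power2 jump_meas)
      finally show ?thesis by (simp add: k_def)
    qed
    have "(\<lambda>k. ennreal c * (?J k + ?J (Suc k))) \<longlonglongrightarrow> ennreal c * (0 + 0)"
      by (intro ennreal_tendsto_cmult tendsto_add J J') simp
    moreover have "filterlim (\<lambda>t. nat \<lfloor>t / period S\<rfloor>) at_top at_top"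
      unfolding filterlim_at_top
    proof
      fix N :: nat
      have "N \<le> nat \<lfloor>t / period S\<rfloor>" if "t \<ge> real N * period S" for t
        using that period_pos by (simp add: le_nat_floor field_simps)
      then show "eventually (\<lambda>t. N \<le> nat \<lfloor>t / period S\<rfloor>) at_top"
        using eventually_ge_at_top eventually_mono by smt
    qed
    ultimately have lim: "((\<lambda>t. ennreal c * (?J (nat \<lfloor>t / period S\<rfloor>) + ?J (Suc (nat \<lfloor>t / period S\<rfloor>)))) \<longlongrightarrow> 0) at_top"
      using filterlim_compose by fastforce
    have "(?X \<longlongrightarrow> 0) at_top"
      by (rule tendsto_sandwich[OF _ _ tendsto_const lim])
         (use bound in \<open>auto intro!: eventually_mono[OF eventually_ge_at_top[of 0]] simp del: jump_state.simps\<close>)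
    then show "(?X \<longlongrightarrow> 0) at_top \<and> ?U \<longlonglongrightarrow> 0" using U by simp
  qed
qed

lemma admissible_control_iff:
  assumes uv: "shifted_by_feedback S u v"
  shows "u \<in> U_c S \<longleftrightarrow> v \<in> U_d S (A_bar S) (B_mat S)"
  unfolding U_c_def U_d_def mem_Collect_eq
  using adapted_iff[OF uv] stable_iff[OF uv] by blast

section \<open>Equality of the costs\<close>

definition stage_cost :: "('m, 'w) control \<Rightarrow> nat \<Rightarrow> 'w \<Rightarrow> real" where
  "stage_cost u k \<omega> = (let \<zeta> = xi S u k \<omega>; \<phi> = phi S k \<omega> in
     \<zeta> \<bullet> (Q_mat S \<phi> *v \<zeta>) + 2 * (\<zeta> \<bullet> (W_mat S \<phi> *v u k \<omega>)) + u k \<omega> \<bullet> (R_mat S \<phi> *v u k \<omega>))"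

text \<open>Cut the time axis into the periods \<open>[kh, (k+1)h)\<close>. The integrand is replaced by the sum of the
  explicit intersample costs \<open>G k\<close>, because these are visibly measurable on the whole line, whereas the
  trajectory is arbitrary at negative times.\<close>

lemma running_cost_eq_suminf:
  assumes \<omega>: "\<omega> \<in> space (sample S)"
  shows "(\<integral>\<^sup>+t\<in>{0..}. ennreal (plant_state S u t \<omega> \<bullet> (Qc S *v plant_state S u t \<omega>)
             + plant_input S u t \<omega> \<bullet> (Rc S *v plant_input S u t \<omega>)) \<partial>lborel)
    = (\<Sum>k. ennreal (stage_cost u k \<omega>))"
proof -
  let ?h = "period S"
  define x where "x k = intersample S (delay S (int k) \<omega>) (plant_state S u (real k * ?h) \<omega>) (prev_input S u k \<omega>) (u k \<omega>)" for k
  define w where "w k \<theta> = (if \<theta> < delay S (int k) \<omega> then prev_input S u k \<omega> else u k \<omega>)" for k \<theta>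
  define g where "g k \<theta> = x k \<theta> \<bullet> (Qc S *v x k \<theta>) + w k \<theta> \<bullet> (Rc S *v w k \<theta>)" for k \<theta>
  define f where "f t = plant_state S u t \<omega> \<bullet> (Qc S *v plant_state S u t \<omega>)
             + plant_input S u t \<omega> \<bullet> (Rc S *v plant_input S u t \<omega>)" for t
  define G where "G k t = ennreal (g k (t - real k * ?h)) * indicator {0..<?h} (t - real k * ?h)" for k t
  have f: "f (real k * ?h + \<theta>) = g k \<theta>" if "0 \<le> \<theta>" "\<theta> < ?h" for k \<theta>
    using that plant_state_within_period[OF \<omega>, of \<theta> u k] plant_input_within_period[OF \<omega>, of \<theta> u k]
    by (simp add: f_def g_def x_def w_def)
  have g_meas: "g k \<in> borel_measurable borel" for k
  proof -
    have "(\<lambda>\<theta>. x k \<theta> \<bullet> (Qc S *v x k \<theta>)) \<in> borel_measurable borel"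
      unfolding x_def by (intro borel_measurable_continuous_onI continuous_intros)
    moreover have "(\<lambda>\<theta>. w k \<theta> \<bullet> (Rc S *v w k \<theta>)) \<in> borel_measurable borel"
      unfolding w_def if_distrib[of "\<lambda>v. v \<bullet> (Rc S *v v)"] by measurable
    ultimately show ?thesis unfolding g_def by measurable
  qed
  have G_meas: "G k \<in> borel_measurable borel" for k
    using g_meas[of k] unfolding G_def by measurable
  have G_int: "(\<integral>\<^sup>+t. G k t \<partial>lborel) = ennreal (stage_cost u k \<omega>)" for k
  proof -
    have "(\<integral>\<^sup>+t. G k t \<partial>lborel) = (\<integral>\<^sup>+\<theta>. ennreal (g k \<theta>) * indicator {0..<?h} \<theta> \<partial>lborel)"
      using nn_integral_real_affine[OF G_meas, of 1 k "real k * ?h"] by (simp add: G_def)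
    also have "\<dots> = (\<integral>\<^sup>+\<theta>. ennreal (g k \<theta>) * indicator {0..?h} \<theta> \<partial>lborel)"
      by (intro nn_integral_cong_AE eventually_mono[OF AE_lborel_singleton[of ?h]])
         (auto simp: indicator_def)
    also have "\<dots> = ennreal (stage_cost u k \<omega>)"
    proof (rule nn_integral_has_integral_lebesgue')
      show "0 \<le> g k \<theta>" for \<theta>
        by (simp add: g_def Qc_nonneg Rc_nonneg)
      show "(g k has_integral stage_cost u k \<omega>) {0..?h}"
        unfolding g_def x_def w_def stage_cost_def Let_def xi_eq
        using period_cost[of "phi S k \<omega>" "plant_state S u (real k * ?h) \<omega>" "prev_input S u k \<omega>" "u k \<omega>"]
          delay_bounds[OF \<omega>, of k]
        by (simp add: phi_0)
    qed
    finally show ?thesis .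
  qed
  have "ennreal (f t) * indicator {0..} t = (\<Sum>k. G k t)" for t
  proof (cases "t \<ge> 0")
    case True
    define j where "j = nat \<lfloor>t / ?h\<rfloor>"
    have "real j = of_int \<lfloor>t / ?h\<rfloor>"
      using True period_pos by (simp add: j_def)
    then have "real j \<le> t / ?h" "t / ?h < real j + 1" by linarith+
    then have j: "0 \<le> t - real j * ?h" "t - real j * ?h < ?h"
      using period_pos by (auto simp: field_simps)
    have "G k t = 0" if "k \<noteq> j" for k
    proof -
      have "t - real k * ?h \<notin> {0..<?h}"
      proof (cases "k < j")
        case True
        then have "real (Suc k) * ?h \<le> real j * ?h"
          using period_pos by (intro mult_right_mono) auto
        then show ?thesis using j by (auto simp: algebra_simps)
      next
        case False
        then have "real (Suc j) * ?h \<le> real k * ?h"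
          using period_pos that by (intro mult_right_mono) auto
        then show ?thesis using j by (auto simp: algebra_simps)
      qed
      then show ?thesis by (simp add: G_def)
    qed
    then have "(\<Sum>k. G k t) = (\<Sum>k\<in>{j}. G k t)"
      by (intro suminf_finite) auto
    also have "\<dots> = ennreal (f t)"
      using f[OF j, of j] j by (simp add: G_def)
    finally show ?thesis using True by simp
  next
    case False
    have "G k t = 0" for k
    proof -
      have "0 \<le> real k * ?h" using period_pos by simp
      then have "t - real k * ?h \<notin> {0..<?h}" using False by auto
      then show ?thesis by (simp add: G_def)
    qed
    then show ?thesis using False by simp
  qed
  then have "(\<integral>\<^sup>+t\<in>{0..}. ennreal (f t) \<partial>lborel) = (\<integral>\<^sup>+t. (\<Sum>k. G k t) \<partial>lborel)"
    by simp
  also have "\<dots> = (\<Sum>k. \<integral>\<^sup>+t. G k t \<partial>lborel)"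
    using G_meas by (intro nn_integral_suminf) simp
  finally show ?thesis by (simp add: G_int f_def)
qed

end

locale sampled_LQ_factored = sampled_LQ S for S :: "('n::finite, 'm::finite, 'w) sampled_system" +
  fixes C :: "(nat \<Rightarrow> real) \<Rightarrow> real ^ ('n + 'm) ^ ('n + 'm)" and D :: "(nat \<Rightarrow> real) \<Rightarrow> real ^ 'm ^ 'm"
  assumes C: "\<And>\<phi>. \<phi> \<in> space (delay_space S) \<Longrightarrow>
      transpose (C \<phi>) ** C \<phi> = Q_mat S \<phi> - W_mat S \<phi> ** matrix_inv (R_mat S \<phi>) ** transpose (W_mat S \<phi>)"
    and D: "\<And>\<phi>. \<phi> \<in> space (delay_space S) \<Longrightarrow> transpose (D \<phi>) ** D \<phi> = R_mat S \<phi>"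
begin

lemma norm_factor_power2: "(norm (X *v v))\<^sup>2 = v \<bullet> ((transpose X ** X) *v v)" for X :: "real ^ 'a ^ 'b"
  by (simp add: power2_norm_eq_inner inner_matrix_transpose matrix_vector_mul_assoc)

lemma stage_cost_eq_factored:
  assumes uv: "shifted_by_feedback S u v" and \<omega>: "\<omega> \<in> space (sample S)"
  shows "stage_cost u k \<omega> = (norm (C (phi S k \<omega>) *v jump_xi S v k \<omega>))\<^sup>2 + (norm (D (phi S k \<omega>) *v v k \<omega>))\<^sup>2"
proof -
  have \<phi>: "phi S k \<omega> \<in> space (delay_space S)"
    using phi_space \<omega> by auto
  have v: "v k \<omega> = u k \<omega> + feedback S (phi S k \<omega>) *v xi S u k \<omega>"
    using uv \<omega> by (simp add: shifted_by_feedback_def)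
  show ?thesis
    unfolding norm_factor_power2 C[OF \<phi>] D[OF \<phi>] jump_xi_eq_xi[OF uv \<omega>] stage_cost_def Let_def v
    using complete_the_square[OF R_mat_invertible[OF \<phi>] transpose_R_mat]
    by (simp add: feedback_def)
qed

lemma J_c_eq_J_d2:
  assumes uv: "shifted_by_feedback S u v" and v: "v \<in> U_d S (A_bar S) (B_mat S)" and \<nu>: "admissible S \<nu>"
  shows "J_c S \<nu> u = J_d2 S (A_bar S) (B_mat S) C D \<nu> v"
proof -
  have adapted: "\<forall>k. v k \<in> borel_measurable (F_jump S v k)"
    using v by (simp add: U_d_def)
  note space = prob_of_sample(2)[OF \<nu>]
  let ?c = "\<lambda>k \<omega>. (norm (C (phi S k \<omega>) *v jump_xi S v k \<omega>))\<^sup>2 + (norm (D (phi S k \<omega>) *v v k \<omega>))\<^sup>2"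
  have meas: "?c k \<in> borel_measurable (prob_of S \<nu>)" for k
  proof -
    let ?P = "\<lambda>\<omega>. Q_mat S (phi S k \<omega>) - W_mat S (phi S k \<omega>) ** matrix_inv (R_mat S (phi S k \<omega>))
        ** transpose (W_mat S (phi S k \<omega>))"
    have "(\<lambda>\<omega>. jump_xi S v k \<omega> \<bullet> (?P \<omega> *v jump_xi S v k \<omega>) + v k \<omega> \<bullet> (R_mat S (phi S k \<omega>) *v v k \<omega>))
        \<in> borel_measurable (sample S)"
      by (intro borel_measurable_add borel_measurable_inner borel_measurable_matrix_vector_mult
          borel_measurable_state_weight borel_measurable_R_mat measurable_phi
          adapted_sample_measurable[OF adapted])
    moreover have "?c k \<omega> = jump_xi S v k \<omega> \<bullet> (?P \<omega> *v jump_xi S v k \<omega>) + v k \<omega> \<bullet> (R_mat S (phi S k \<omega>) *v v k \<omega>)"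
      if "\<omega> \<in> space (sample S)" for \<omega>
      using phi_space that by (simp add: norm_factor_power2 C D Pi_iff)
    ultimately have "?c k \<in> borel_measurable (sample S)"
      by (rule measurable_cong[THEN iffD2, rotated])
    then show ?thesis
      by (simp add: measurable_cong_sets[OF prob_of_sample(1)[OF \<nu>] refl])
  qed
  have "J_c S \<nu> u = (\<integral>\<^sup>+\<omega>. (\<Sum>k. ennreal (?c k \<omega>)) \<partial>prob_of S \<nu>)"
    unfolding J_c_def
    by (intro nn_integral_cong) (simp add: space running_cost_eq_suminf stage_cost_eq_factored[OF uv])
  also have "\<dots> = (\<Sum>k. \<integral>\<^sup>+\<omega>. ennreal (?c k \<omega>) \<partial>prob_of S \<nu>)"
    using meas by (intro nn_integral_suminf measurable_compose[OF _ measurable_ennreal])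
  finally show ?thesis by (simp add: J_d2_def)
qed

text \<open>Each control of one problem has a partner in the other with the same cost.\<close>

lemma optimal_cost_eq:
  assumes \<nu>: "admissible S \<nu>"
  shows "(INF u\<in>U_c S. J_c S \<nu> u)
    = (INF v\<in>U_d S (A_bar S) (B_mat S). J_d2 S (A_bar S) (B_mat S) C D \<nu> v)"
proof (rule antisym; rule INF_mono)
  fix v assume v: "v \<in> U_d S (A_bar S) (B_mat S)"
  obtain u where uv: "shifted_by_feedback S u v" using jump_control_is_shifted by blast
  then show "\<exists>u\<in>U_c S. J_c S \<nu> u \<le> J_d2 S (A_bar S) (B_mat S) C D \<nu> v"
    using admissible_control_iff[OF uv] J_c_eq_J_d2[OF uv v \<nu>] v by (intro bexI[of _ u]) auto
next
  fix u assume u: "u \<in> U_c S"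
  have uv: "shifted_by_feedback S u (\<lambda>k \<omega>. u k \<omega> + feedback S (phi S k \<omega>) *v xi S u k \<omega>)" (is "shifted_by_feedback S u ?v")
    by (simp add: shifted_by_feedback_def)
  then have "?v \<in> U_d S (A_bar S) (B_mat S)"
    using admissible_control_iff[OF uv] u by simp
  then show "\<exists>v\<in>U_d S (A_bar S) (B_mat S). J_d2 S (A_bar S) (B_mat S) C D \<nu> v \<le> J_c S \<nu> u"
    using J_c_eq_J_d2[OF uv _ \<nu>] by auto
qed

lemma solves_iff:
  assumes uv: "shifted_by_feedback S u v"
  shows "solves_sampled_LQ S u \<longleftrightarrow> solves_jump_LQ S (A_bar S) (B_mat S) C D v"
  unfolding solves_sampled_LQ_def solves_jump_LQ_def
  using admissible_control_iff[OF uv] J_c_eq_J_d2[OF uv] optimal_cost_eq by auto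

end

section \<open>Equivalence of the two problems\<close>

theorem theorem3p6:
  fixes S :: "('n::finite, 'm::finite, 'w) sampled_system"
    and C :: "(nat \<Rightarrow> real) \<Rightarrow> real ^ ('n + 'm) ^ ('n + 'm)"
    and D :: "(nat \<Rightarrow> real) \<Rightarrow> real ^ 'm ^ 'm"
    and u_opt :: "('m, 'w) control"
  assumes "0 < period S" and "1 \<le> lags S"
    and "0 \<le> tau_min S" and "tau_min S \<le> tau_max S" and "tau_max S < period S"
    and "pos_semidef (Qc S)" and "pos_def (Rc S)"
    and "transition_kernel_density S" and "markov_delays S"
    and "\<forall>\<phi>\<in>space (delay_space S).
           transpose (C \<phi>) ** C \<phi>
           = Q_mat S \<phi> - W_mat S \<phi> ** matrix_inv (R_mat S \<phi>) ** transpose (W_mat S \<phi>)"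
    and "\<forall>\<phi>\<in>space (delay_space S). transpose (D \<phi>) ** D \<phi> = R_mat S \<phi>"
  shows "solves_sampled_LQ S u_opt \<longleftrightarrow>
         solves_jump_LQ S (A_bar S) (B_mat S) C D
           (\<lambda>k \<omega>. u_opt k \<omega>
              + (matrix_inv (R_mat S (phi S k \<omega>)) ** transpose (W_mat S (phi S k \<omega>))) *v xi S u_opt k \<omega>)"
proof -
  interpret sampled_LQ_factored S C D
    by unfold_locales (use assms in auto)
  show ?thesis
    by (rule solves_iff) (simp add: shifted_by_feedback_def feedback_def)
qed

end
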